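(* Let $\mu\ge0$. There is a constant $C_{o,\mu}>0$, with $C_{o,\mu}<1$ if $\mu>0$ and $C_{o,0}=1$, satisfying $$C_{o,\mu}E_{o,\mu}(f_o)\le\int_{\mathbf{C}}|z|^2|f_o(z)|^2\,d\nu_{e,\mu}(z)\quad\text{for all }f_o\in\mathcal{B}^2_{o,\mu},$$ and there are real constants $a_e>0$, $b_e>0$, $c_e\ge0$, $a_o>0$, $b_o>0$, $c_o\ge0$ such that the following hold. For all $f_e\in\mathcal{B}^2_{e,\mu}$, $$a_e\,S_{L^2(\nu_{e,\mu})}(f_e)\le b_e\|D_\mu f_e\|^2_{\mathcal{B}^2_\mu}+\left(b_e(1+2\mu)+c_e\right)\|f_e\|^2_{L^2(\nu_{e,\mu})}.$$ For all $f_o\in\mathcal{B}^2_{o,\mu}$, $$a_o\,S_{L^2(\nu_{o,\mu})}(f_o)\le b_oC_{o,\mu}^{-1}\|D_\mu f_o\|^2_{\mathcal{B}^2_\mu}+\left(b_oC_{o,\mu}^{-1}(1-2\mu)+c_o\right)\|f_o\|^2_{L^2(\nu_{o,\mu})}.$$ For every $f=f_e+f_o\in\mathcal{B}^2_\mu$, $$a_eS_{L^2(\nu_{e,\mu})}(f_e)+a_oS_{L^2(\nu_{o,\mu})}(f_o)\le b_e\|D_\mu f_e\|^2_{\mathcal{B}^2_\mu}+b_oC_{o,\mu}^{-1}\|D_\mu f_o\|^2_{\mathcal{B}^2_\mu}+\left(b_e(1+2\mu)+c_e\right)\|f_e\|^2_{L^2(\nu_{e,\mu})}+\left(b_oC_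{o,\mu}^{-1}(1-2\mu)+c_o\right)\|f_o\|^2_{L^2(\nu_{o,\mu})}.$$
   Context: Fix $\mu\ge0$. For $x>0$ and $\alpha\in\mathbf{R}$, $K_\alpha(x)=\int_0^\infty e^{-x\cosh u}\cosh(\alpha u)\,du$ is the Macdonald function. On $\mathbf{C}$ define the finite measures $d\nu_{e,\mu}(z)=\nu_{e,\mu}(z)\,dx\,dy$ and $d\nu_{o,\mu}(z)=\nu_{o,\mu}(z)\,dx\,dy$ with densities, for $z\neq0$, $$\nu_{e,\mu}(z)=\frac{2^{\frac12-\mu}}{\pi\Gamma(\mu+\frac12)}K_{\mu-\frac12}(|z|^2)|z|^{2\mu+1},\qquad \nu_{o,\mu}(z)=\frac{2^{\frac12-\mu}}{\pi\Gamma(\mu+\frac12)}K_{\mu+\frac12}(|z|^2)|z|^{2\mu+1}.$$ For $f:\mathbf{C}\to\mathbf{C}$, $f_e(z)=(f(z)+f(-z))/2$ and $f_o(z)=(f(z)-f(-z))/2$ are its even and odd parts. $\mathcal{B}^2_\mu$ is the space of entire functions $f$ with $f_e\in L^2(\mathbf{C},\nu_{e,\mu})$ and $f_o\in L^2(\mathbf{C},\nu_{o,\mu})$, with norm $\|f\|^2_{\mathcal{B}^2_\mu}=\|f_e\|^2_{L^2(\nu_{e,\mu})}+\|f_o\|^2_{L^2(\nu_{o,\mu})}$; $\mathcal{B}^2_{e,\mu}$ and $\mathcal{B}^2_{o,\mu}$ are its subspaces of even and odd functions. Entropy: for a finite measure space $(\Omega,\nu)$ and $f\in L^2(\Omega,\nu)$,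 $S_{L^2(\Omega,\nu)}(f)=\int_\Omega|f|^2\log|f|^2\,d\nu-\|f\|^2_{L^2}\log\|f\|^2_{L^2}\in(-\infty,+\infty]$, with $0\log0=0$; here $\Omega=\mathbf{C}$. $\mu$-deformed energy (values in $[0,+\infty]$): $E_{o,\mu}(h)=\int_{\mathbf{C}}|z|^2|h(z)|^2\,d\nu_{o,\mu}(z)$ for $h\in\mathcal{B}^2_{o,\mu}$. For an entire function $f$, $D_\mu f(z)=f'(z)+\frac{\mu}{z}(f(z)-f(-z))$ (removable singularity at $0$). The Dirichlet energy of $f\in\mathcal{B}^2_\mu$ is $\|D_\mu f\|^2_{\mathcal{B}^2_\mu}$ if $D_\mu f\in\mathcal{B}^2_\mu$ and $+\infty$ otherwise. *)

theory Defs
  imports "HOL-Complex_Analysis.Complex_Analysis"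
begin

definition macdonald :: "real \<Rightarrow> real \<Rightarrow> real" where
  "macdonald \<alpha> x = (LBINT u:{0..}. exp (- x * cosh u) * cosh (\<alpha> * u))"

(* The densities are only meaningful for z \<noteq> 0; the value given by the formula
   at the null point 0 is irrelevant. *)

definition dens_e :: "real \<Rightarrow> complex \<Rightarrow> real" where
  "dens_e \<mu> z = 2 powr (1/2 - \<mu>) / (pi * Gamma (\<mu> + 1/2))
      * macdonald (\<mu> - 1/2) ((cmod z)\<^sup>2) * cmod z powr (2 * \<mu> + 1)"

definition dens_o :: "real \<Rightarrow> complex \<Rightarrow> real" where
  "dens_o \<mu> z = 2 powr (1/2 - \<mu>) / (pi * Gamma (\<mu> + 1/2))
      * macdonald (\<mu> + 1/2) ((cmod z)\<^sup>2) * cmod z powr (2 * \<mu> + 1)"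

definition nu_e :: "real \<Rightarrow> complex measure" where
  "nu_e \<mu> = density lborel (\<lambda>z. ennreal (dens_e \<mu> z))"

definition nu_o :: "real \<Rightarrow> complex measure" where
  "nu_o \<mu> = density lborel (\<lambda>z. ennreal (dens_o \<mu> z))"

definition even_part :: "(complex \<Rightarrow> complex) \<Rightarrow> complex \<Rightarrow> complex" where
  "even_part f z = (f z + f (- z)) / 2"

definition odd_part :: "(complex \<Rightarrow> complex) \<Rightarrow> complex \<Rightarrow> complex" where
  "odd_part f z = (f z - f (- z)) / 2"

definition L2 :: "'a measure \<Rightarrow> ('a \<Rightarrow> complex) set" where
  "L2 M = {f \<in> borel_measurable M. integrable M (\<lambda>x. (cmod (f x))\<^sup>2)}"

definition L2_norm :: "'a measure \<Rightarrow> ('a \<Rightarrow> complex) \<Rightarrow> real" where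
  "L2_norm M f = sqrt (LINT x|M. (cmod (f x))\<^sup>2)"

definition B2 :: "real \<Rightarrow> (complex \<Rightarrow> complex) set" where
  "B2 \<mu> = {f. f holomorphic_on UNIV \<and> even_part f \<in> L2 (nu_e \<mu>) \<and> odd_part f \<in> L2 (nu_o \<mu>)}"

definition B2_norm :: "real \<Rightarrow> (complex \<Rightarrow> complex) \<Rightarrow> real" where
  "B2_norm \<mu> f = sqrt ((L2_norm (nu_e \<mu>) (even_part f))\<^sup>2 + (L2_norm (nu_o \<mu>) (odd_part f))\<^sup>2)"

definition B2_e :: "real \<Rightarrow> (complex \<Rightarrow> complex) set" where
  "B2_e \<mu> = {f \<in> B2 \<mu>. \<forall>z. f (- z) = f z}"

definition B2_o :: "real \<Rightarrow> (complex \<Rightarrow> complex) set" where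
  "B2_o \<mu> = {f \<in> B2 \<mu>. \<forall>z. f (- z) = - f z}"

(* Meant for finite M and f in L2 M.  The integral of |f|^2 log |f|^2 is taken as the
   difference of the integrals of its positive and negative parts (ennreal truncates
   negative reals to 0).  The negative part is bounded by 1/e, so on a finite measure
   space the value is never -\<infinity>, but it may be \<infinity>. *)
definition entropy :: "'a measure \<Rightarrow> ('a \<Rightarrow> complex) \<Rightarrow> ereal" where
  "entropy M f =
     enn2ereal (\<integral>\<^sup>+x. ennreal ((cmod (f x))\<^sup>2 * ln ((cmod (f x))\<^sup>2)) \<partial>M)
   - enn2ereal (\<integral>\<^sup>+x. ennreal (- ((cmod (f x))\<^sup>2 * ln ((cmod (f x))\<^sup>2))) \<partial>M)
   - ereal ((L2_norm M f)\<^sup>2 * ln ((L2_norm M f)\<^sup>2))"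

definition energy_o :: "real \<Rightarrow> (complex \<Rightarrow> complex) \<Rightarrow> ennreal" where
  "energy_o \<mu> h = (\<integral>\<^sup>+z. ennreal ((cmod z)\<^sup>2 * (cmod (h z))\<^sup>2) \<partial>nu_o \<mu>)"

(* remove_sings fills in the limit at the removable singularity 0. *)
definition D :: "real \<Rightarrow> (complex \<Rightarrow> complex) \<Rightarrow> complex \<Rightarrow> complex" where
  "D \<mu> f = remove_sings (\<lambda>z. deriv f z + of_real \<mu> / z * (f z - f (- z)))"

definition dirichlet_energy :: "real \<Rightarrow> (complex \<Rightarrow> complex) \<Rightarrow> ereal" where
  "dirichlet_energy \<mu> f = (if D \<mu> f \<in> B2 \<mu> then ereal ((B2_norm \<mu> (D \<mu> f))\<^sup>2) else \<infinity>)"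

end

theory Submission
  imports Defs
begin

text \<open>
  All weights are radial, so integrating over circles first turns every quadratic integral of an entire
  function into a sum over its Taylor coefficients weighted by radial moments. By Tonelli, the moments
  of the Macdonald weights are \<open>\<Gamma>(\<sigma>)\<close> times \<open>\<integral> cosh (\<alpha>u) / cosh\<^sup>\<sigma> u du\<close>, with \<open>\<sigma> = n + \<mu> + 3/2\<close>.
  Consequently ratios of consecutive moments grow at most linearly in \<open>n\<close>, the moments of \<open>\<nu>\<^sub>o\<close> are bounded by a multiple
  of those of \<open>\<nu>\<^sub>e\<close> (which gives \<open>C\<close>), and \<open>\<integral> |z|\<^sup>2|f|\<^sup>2\<close> is bounded by the Dirichlet energy and the
  norm, coefficient by coefficient. A lower bound on the moments and Cauchy-Schwarz give a pointwise bound
  \<open>|f(z)|\<^sup>2 \<le> K exp (s|z|\<^sup>2) \<parallel>f\<parallel>\<^sup>2\<close>; inserted in the logarithm, it bounds the entropy by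
  \<open>s \<integral> |z|\<^sup>2|f|\<^sup>2 + |log K| \<parallel>f\<parallel>\<^sup>2\<close>.
\<close>

section \<open>Rotations and radial integrals in the plane\<close>

text \<open>The two measures agree on open boxes, and this determines \<open>lborel\<close>. The
  identification makes Tonelli in real and imaginary part available on the complex plane.\<close>

lemma lborel_complex_eq_distr:
  "lborel = distr (lborel \<Otimes>\<^sub>M lborel) borel (\<lambda>(x, y). Complex x y)"
proof (rule lborel_eqI)
  fix l u :: complex
  assume lu: "\<And>b. b \<in> Basis \<Longrightarrow> l \<bullet> b \<le> u \<bullet> b"
  have l1: "Re l \<le> Re u" "Im l \<le> Im u"
    using lu[of 1] lu[of \<i>] by (auto simp: Basis_complex_def inner_complex_def)
  have m: "(\<lambda>(x, y). Complex x y) \<in> (lborel \<Otimes>\<^sub>M lborel) \<rightarrow>\<^sub>M borel"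
    unfolding lborel_prod by (auto intro!: borel_measurable_continuous_onI continuous_intros simp: case_prod_beta Complex_eq)
  have "(\<lambda>(x, y). Complex x y) -` box l u \<inter> space (lborel \<Otimes>\<^sub>M lborel)
      = {Re l<..<Re u} \<times> {Im l<..<Im u}"
    by (auto simp: space_pair_measure in_box_complex_iff)
  then show "emeasure (distr (lborel \<Otimes>\<^sub>M lborel) borel (\<lambda>(x, y). Complex x y)) (box l u)
       = ennreal (\<Prod>b\<in>Basis. (u - l) \<bullet> b)"
    using l1 by (simp add: emeasure_distr[OF m] lborel.emeasure_pair_measure_Times
        Basis_complex_def inner_complex_def ennreal_mult)
qed simp

lemma borel_measurable_Complex [measurable (raw)]:
  assumes "f \<in> borel_measurable M" "g \<in> borel_measurable M"
  shows "(\<lambda>x. Complex (f x) (g x)) \<in> borel_measurable M"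
  unfolding Complex_eq using assms by measurable

lemma nn_integral_complex:
  assumes [measurable]: "f \<in> borel_measurable borel"
  shows "(\<integral>\<^sup>+z. f z \<partial>lborel) = (\<integral>\<^sup>+x. \<integral>\<^sup>+y. f (Complex x y) \<partial>lborel \<partial>lborel)"
    and "(\<integral>\<^sup>+z. f z \<partial>lborel) = (\<integral>\<^sup>+y. \<integral>\<^sup>+x. f (Complex x y) \<partial>lborel \<partial>lborel)"
proof -
  show *: "(\<integral>\<^sup>+z. f z \<partial>lborel) = (\<integral>\<^sup>+x. \<integral>\<^sup>+y. f (Complex x y) \<partial>lborel \<partial>lborel)"
    by (subst lborel_complex_eq_distr)
       (simp add: nn_integral_distr case_prod_beta lborel.nn_integral_fst[symmetric])
  show "(\<integral>\<^sup>+z. f z \<partial>lborel) = (\<integral>\<^sup>+y. \<integral>\<^sup>+x. f (Complex x y) \<partial>lborel \<partial>lborel)"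
    unfolding * by (rule lborel_pair.Fubini') simp
qed

lemma nn_integral_lborel_shift:
  fixes c :: real
  assumes [measurable]: "f \<in> borel_measurable borel"
  shows "(\<integral>\<^sup>+x. f (x + c) \<partial>lborel) = (\<integral>\<^sup>+x. f x \<partial>lborel)"
  using nn_integral_real_affine[of f 1 c] by (simp add: add.commute)

text \<open>With the real part as the inner variable and \<open>Im z\<close> fixed, a shear is a
  translation of the line. The companion for the imaginary part exchanges the roles.\<close>

lemma nn_integral_shear_Re:
  assumes [measurable]: "f \<in> borel_measurable borel"
  shows "(\<integral>\<^sup>+z. f (Complex (Re z + c * Im z) (Im z)) \<partial>lborel) = (\<integral>\<^sup>+z. f z \<partial>lborel)"
  by (simp add: nn_integral_complex(2) nn_integral_lborel_shift[of "\<lambda>x. f (Complex x _)"])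

lemma nn_integral_shear_Im:
  assumes [measurable]: "f \<in> borel_measurable borel"
  shows "(\<integral>\<^sup>+z. f (Complex (Re z) (Im z + c * Re z)) \<partial>lborel) = (\<integral>\<^sup>+z. f z \<partial>lborel)"
  by (simp add: nn_integral_complex(1) nn_integral_lborel_shift[of "\<lambda>x. f (Complex _ x)"])

lemma nn_integral_rotate:
  assumes f [measurable]: "f \<in> borel_measurable borel" and u: "cmod u = 1"
  shows "(\<integral>\<^sup>+z. f (u * z) \<partial>lborel) = (\<integral>\<^sup>+z. f z \<partial>lborel)"
proof -
  \<comment> \<open>A rotation with angle \<open>\<theta>\<close> other than a multiple of \<open>\<pi>\<close> is a product of three shears, with \<open>t = tan (\<theta>/2)\<close>.\<close>
  have rot: "(\<integral>\<^sup>+z. f (u * z) \<partial>lborel) = (\<integral>\<^sup>+z. f z \<partial>lborel)"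
    if f [measurable]: "f \<in> borel_measurable borel" and u: "cmod u = 1" and b: "Im u \<noteq> 0"
    for f :: "complex \<Rightarrow> ennreal" and u
  proof -
    define t where "t = (1 - Re u) / Im u"
    have tb: "t * Im u = 1 - Re u" using b by (simp add: t_def)
    have "(Re u)\<^sup>2 + (Im u)\<^sup>2 = 1" using u by (simp add: cmod_def)
    then have "(1 - Re u) * (1 + Re u) = Im u * Im u" by (simp add: algebra_simps power2_eq_square)
    then have ta: "t * (1 + Re u) = Im u" using b by (simp add: t_def)
    let ?S = "\<lambda>z. Complex (Re z + (- t) * Im z) (Im z)"
    let ?T = "\<lambda>z. Complex (Re z) (Im z + Im u * Re z)"
    have *: "?S (?T (?S z)) = u * z" for z
    proof -
      have i: "Im z + Im u * (Re z + (- t) * Im z) = Im (u * z)"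
        using tb by (simp add: algebra_simps) (metis (no_types) add.commute diff_add_cancel distrib_left mult.commute mult.left_commute mult.right_neutral)
      have "Re z + (- t) * Im z + (- t) * Im (u * z) = Re z * (1 - t * Im u) - t * (1 + Re u) * Im z"
        by (simp add: algebra_simps)
      also have "\<dots> = Re (u * z)" unfolding ta tb by (simp add: algebra_simps)
      finally show ?thesis using i by (simp add: complex_eq_iff)
    qed
    have "(\<integral>\<^sup>+z. f z \<partial>lborel) = (\<integral>\<^sup>+z. f (?S z) \<partial>lborel)"
      by (rule nn_integral_shear_Re[symmetric]) simp
    also have "\<dots> = (\<integral>\<^sup>+z. f (?S (?T z)) \<partial>lborel)"
      by (rule nn_integral_shear_Im[of "\<lambda>z. f (?S z)", symmetric]) measurable
    also have "\<dots> = (\<integral>\<^sup>+z. f (?S (?T (?S z))) \<partial>lborel)"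
      by (rule nn_integral_shear_Re[of "\<lambda>z. f (?S (?T z))", symmetric]) measurable
    finally show ?thesis unfolding * by simp
  qed
  show ?thesis
  proof (cases "Im u = 0")
    case False
    then show ?thesis using rot f u by blast
  next
    case True
    have "(\<integral>\<^sup>+z. f (u * z) \<partial>lborel) = (\<integral>\<^sup>+z. f (u * (\<i> * z)) \<partial>lborel)"
      by (rule rot[of "\<lambda>z. f (u * z)", symmetric]) auto
    also have "\<dots> = (\<integral>\<^sup>+z. f (u * \<i> * z) \<partial>lborel)" by (simp add: mult.assoc)
    also have "\<dots> = (\<integral>\<^sup>+z. f z \<partial>lborel)"
      using True u by (intro rot f) (auto simp: norm_mult cmod_def)
    finally show ?thesis .
  qed
qed

text \<open>The disc of radius sqrt a has area pi * a, so |z|^2 pushes Lebesgue measure forward to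
  pi times Lebesgue measure on the half-line. This replaces polar coordinates.\<close>

lemma nn_integral_cmod_square:
  assumes [measurable]: "g \<in> borel_measurable borel"
  shows "(\<integral>\<^sup>+z. g ((cmod z)\<^sup>2) \<partial>(lborel :: complex measure)) = ennreal pi * (\<integral>\<^sup>+x. g x * indicator {0..} x \<partial>lborel)"
proof -
  let ?M = "distr lborel borel (\<lambda>z::complex. (cmod z)\<^sup>2)"
  let ?N = "density lborel (\<lambda>x::real. ennreal pi * indicator {0..} x)"
  have em: "emeasure ?M {..a} = ennreal (pi * max 0 a)" for a :: real
  proof -
    have "(\<lambda>z::complex. (cmod z)\<^sup>2) -` {..a} = (if a < 0 then {} else cball 0 (sqrt a))"
      using real_le_rsqrt real_sqrt_ge_zero by (auto simp: not_less intro: real_le_rsqrt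
          dest: sqrt_le_D) (smt (verit) zero_le_power2, metis norm_ge_zero power_mono real_sqrt_pow2)
    then show ?thesis
      by (auto simp: emeasure_distr emeasure_cball max_def unit_ball_vol_2)
  qed
  have en: "emeasure ?N {..a} = ennreal (pi * max 0 a)" for a :: real
  proof -
    have "emeasure ?N {..a} = (\<integral>\<^sup>+x. ennreal pi * indicator {0..a} x \<partial>lborel)"
      by (subst emeasure_density) (auto intro!: nn_integral_cong simp: indicator_def)
    also have "\<dots> = ennreal (pi * max 0 a)"
      by (auto simp: nn_integral_cmult ennreal_mult max_def)
    finally show ?thesis .
  qed
  have borel: "sets (borel :: real measure) = sigma_sets UNIV (range atMost)"
    by (simp add: borel_eq_atMost)
  \<comment> \<open>Half-lines are stable under intersection and generate the Borel sets, and the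
    sets \<open>{..real i}\<close> of finite measure exhaust the line.\<close>
  have "?M = ?N"
  proof (rule measure_eqI_generator_eq[where E = "range atMost" and \<Omega> = UNIV and A = "\<lambda>i. {..real i}"])
    show "Int_stable (range atMost :: real set set)"
      by (auto simp: Int_stable_def)
    show "(\<Union>i. {..real i}) = UNIV" using real_arch_simple by auto
  qed (simp_all only: sets_distr sets_density sets_lborel borel, auto simp: em en)
  then have "(\<integral>\<^sup>+x. g x \<partial>?M) = (\<integral>\<^sup>+x. g x \<partial>?N)" by simp
  then show ?thesis
    by (simp add: nn_integral_distr nn_integral_density mult.assoc nn_integral_cmult mult.commute[of "g _"])
qed

section \<open>Parseval identity for radial weights\<close>

text \<open>For \<open>k \<noteq> 0\<close> the antiderivative has period 1. The circle is
  parametrized by [0,1], so that its total mass is 1 and no factor 2 pi appears later.\<close>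

lemma has_integral_cis_period:
  fixes k :: int
  shows "((\<lambda>t. cis (2 * pi * k * t)) has_integral (if k = 0 then 1 else 0)) {0..1}"
proof (cases "k = 0")
  case False
  let ?F = "\<lambda>t::real. cis (2 * pi * k * t) / (2 * pi * k * \<i>)"
  have "((\<lambda>t. cis (2 * pi * k * t)) has_integral (?F 1 - ?F 0)) {0..1}"
  proof (rule fundamental_theorem_of_calculus)
    fix t :: real
    let ?c = "of_real (2 * pi * k) * \<i>"
    have "((\<lambda>w. exp (?c * w) / ?c) has_field_derivative exp (?c * of_real t)) (at (of_real t))"
      using False by (auto intro!: derivative_eq_intros)
    from has_vector_derivative_real_field[OF this, of "{0..1}"]
    show "(?F has_vector_derivative cis (2 * pi * k * t)) (at t within {0..1})"
      by (simp add: cis_conv_exp mult_ac)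
  qed simp
  moreover have "cis (2 * pi * k) = 1"
    by (simp add: cis_multiple_2pi)
  ultimately show ?thesis using False by simp
qed (use has_integral_const_real[of "1::complex" 0 1] in simp)

text \<open>The square expands to a double sum of characters of frequency n - m; orthogonality
  leaves the diagonal.\<close>

lemma has_integral_trig_polynomial_square:
  fixes b :: "nat \<Rightarrow> complex"
  shows "((\<lambda>t. (cmod (\<Sum>n<N. b n * cis (2 * pi * n * t)))\<^sup>2) has_integral (\<Sum>n<N. (cmod (b n))\<^sup>2)) {0..1}"
proof -
  have eq: "complex_of_real ((cmod (\<Sum>n<N. b n * cis (2 * pi * n * t)))\<^sup>2) =
      (\<Sum>n<N. \<Sum>m<N. b n * cnj (b m) * cis (2 * pi * (int n - int m) * t))" for t
  proof -
    have "complex_of_real ((cmod (\<Sum>n<N. b n * cis (2 * pi * n * t)))\<^sup>2) =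
        (\<Sum>n<N. b n * cis (2 * pi * n * t)) * (\<Sum>m<N. cnj (b m) * cis (- (2 * pi * m * t)))"
      unfolding complex_norm_square by (simp add: cis_cnj)
    also have "\<dots> = (\<Sum>n<N. \<Sum>m<N. b n * cnj (b m) * (cis (2 * pi * n * t) * cis (- (2 * pi * m * t))))"
      by (simp add: sum_product mult_ac)
    also have "\<dots> = (\<Sum>n<N. \<Sum>m<N. b n * cnj (b m) * cis (2 * pi * (int n - int m) * t))"
      by (simp add: cis_mult algebra_simps)
    finally show ?thesis .
  qed
  have "((\<lambda>t. \<Sum>n<N. \<Sum>m<N. b n * cnj (b m) * cis (2 * pi * (int n - int m) * t)) has_integral
      (\<Sum>n<N. \<Sum>m<N. b n * cnj (b m) * (if int n - int m = 0 then 1 else 0))) {0..1}"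
    by (intro has_integral_sum has_integral_mult_right finite_lessThan has_integral_cis_period)
  also have "(\<Sum>n<N. \<Sum>m<N. b n * cnj (b m) * (if int n - int m = 0 then 1 else 0)) =
      complex_of_real (\<Sum>n<N. (cmod (b n))\<^sup>2)"
    unfolding of_real_sum complex_norm_square by (simp add: if_distrib[of "\<lambda>x. _ * x"] cong: if_cong)
  finally have "((\<lambda>t. complex_of_real ((cmod (\<Sum>n<N. b n * cis (2 * pi * n * t)))\<^sup>2)) has_integral
      complex_of_real (\<Sum>n<N. (cmod (b n))\<^sup>2)) {0..1}"
    unfolding eq .
  from has_integral_linear[OF this bounded_linear_Re] show ?thesis
    by (simp add: o_def)
qed

text \<open>Convergence at the point \<open>cmod z + 1\<close>, of larger modulus, forces absolute
  convergence at \<open>z\<close>.\<close>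

lemma entire_power_series_abs_summable:
  fixes a :: "nat \<Rightarrow> complex"
  assumes "\<And>z. (\<lambda>n. a n * z ^ n) sums f z"
  shows "summable (\<lambda>n. cmod (a n * z ^ n))"
  using assms[of "of_real (cmod z + 1)"]
  by (intro powser_insidea[where x = "of_real (cmod z + 1)"]) (auto simp: sums_iff simp flip: of_real_add)

text \<open>The identity for partial sums passes to the limit by dominated convergence: absolute
  summability at \<open>z\<close> bounds all partial sums on the circle by one constant.\<close>

lemma circle_parseval:
  fixes a :: "nat \<Rightarrow> complex"
  assumes a: "\<And>z. (\<lambda>n. a n * z ^ n) sums f z"
  shows "(\<integral>\<^sup>+t. ennreal ((cmod (f (cis (2 * pi * t) * z)))\<^sup>2) * indicator {0..1} t \<partial>lborel)
    = (\<Sum>n. ennreal ((cmod (a n))\<^sup>2 * cmod z ^ (2 * n)))"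
proof -
  define b where "b n = a n * z ^ n" for n
  have summ: "summable (\<lambda>n. cmod (b n))"
    unfolding b_def by (rule entire_power_series_abs_summable[OF a])
  have sq: "(cmod (b n))\<^sup>2 = (cmod (a n))\<^sup>2 * cmod z ^ (2 * n)" for n
    by (simp add: b_def norm_mult norm_power power_mult_distrib power_mult[symmetric] mult.commute)
  have bound: "cmod (\<Sum>n<N. b n * cis (2 * pi * n * t)) \<le> (\<Sum>n. cmod (b n))" for N t
  proof -
    have "cmod (\<Sum>n<N. b n * cis (2 * pi * n * t)) \<le> (\<Sum>n<N. cmod (b n))"
      by (rule order_trans[OF norm_sum]) (simp add: norm_mult)
    also have "\<dots> \<le> (\<Sum>n. cmod (b n))" by (intro sum_le_suminf summ) auto
    finally show ?thesis .
  qed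
  have pow: "(cis (2 * pi * t) * z) ^ n = z ^ n * cis (2 * pi * n * t)" for n t
  proof -
    have "cis (2 * pi * t) ^ n = cis (real n * (2 * pi * t))" by (rule Complex.DeMoivre)
    also have "real n * (2 * pi * t) = 2 * pi * n * t" by simp
    finally show ?thesis by (simp add: power_mult_distrib)
  qed
  have lim: "(\<lambda>N. \<Sum>n<N. b n * cis (2 * pi * n * t)) \<longlonglongrightarrow> f (cis (2 * pi * t) * z)" for t
    using a[of "cis (2 * pi * t) * z"]
    unfolding sums_def b_def pow by (simp add: mult.assoc)
  \<comment> \<open>The terms are eventually below 1, hence dominate their squares.\<close>
  have summ2: "summable (\<lambda>n. (cmod (b n))\<^sup>2)"
  proof (rule summable_comparison_test_ev)
    have "eventually (\<lambda>n. cmod (b n) < 1) sequentially"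
      using summable_LIMSEQ_zero[OF summ] by (rule order_tendstoD) simp
    then show "eventually (\<lambda>n. norm ((cmod (b n))\<^sup>2) \<le> cmod (b n)) sequentially"
      by eventually_elim (auto simp: power2_eq_square intro!: mult_left_le)
  qed (rule summ)
  have "((\<lambda>t. (cmod (f (cis (2 * pi * t) * z)))\<^sup>2) has_integral (\<Sum>n. (cmod (b n))\<^sup>2)) {0..1}"
  proof (rule has_integral_dominated_convergence)
    show "((\<lambda>t. (cmod (\<Sum>n<N. b n * cis (2 * pi * n * t)))\<^sup>2) has_integral (\<Sum>n<N. (cmod (b n))\<^sup>2)) {0..1}" for N
      by (rule has_integral_trig_polynomial_square)
    show "(\<lambda>t::real. (\<Sum>n. cmod (b n))\<^sup>2) integrable_on {0..1}"
      by (rule integrable_const_ivl)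
    show "\<forall>t\<in>{0..1}. norm ((cmod (\<Sum>n<N. b n * cis (2 * pi * n * t)))\<^sup>2) \<le> (\<Sum>n. cmod (b n))\<^sup>2" for N
      using bound by (auto intro!: power_mono)
    show "\<forall>t\<in>{0..1}. (\<lambda>N. (cmod (\<Sum>n<N. b n * cis (2 * pi * n * t)))\<^sup>2) \<longlonglongrightarrow> (cmod (f (cis (2 * pi * t) * z)))\<^sup>2"
      by (intro ballI tendsto_intros lim)
    show "(\<lambda>N. \<Sum>n<N. (cmod (b n))\<^sup>2) \<longlonglongrightarrow> (\<Sum>n. (cmod (b n))\<^sup>2)"
      using summ2 by (rule summable_LIMSEQ)
  qed
  from nn_integral_has_integral_lebesgue'[OF _ this]
  have "(\<integral>\<^sup>+t. ennreal ((cmod (f (cis (2 * pi * t) * z)))\<^sup>2) * indicator {0..1} t \<partial>lborel)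
      = ennreal (\<Sum>n. (cmod (b n))\<^sup>2)"
    by simp
  also have "\<dots> = (\<Sum>n. ennreal ((cmod (b n))\<^sup>2))"
    by (rule suminf_ennreal2[symmetric]) (simp_all add: summ2)
  finally show ?thesis unfolding sq .
qed

text \<open>The integral is averaged over all rotations, the averaging is moved inside by Tonelli,
  and on each circle \<open>circle_parseval\<close> applies. The identity holds in [0,\<infinity>],
  so it can be used before any integral is known to be finite.\<close>

lemma radial_parseval:
  fixes a :: "nat \<Rightarrow> complex" and W :: "complex \<Rightarrow> ennreal"
  assumes a: "\<And>z. (\<lambda>n. a n * z ^ n) sums f z" and f: "f holomorphic_on UNIV"
    and W [measurable]: "W \<in> borel_measurable borel" and radial: "\<And>u z. cmod u = 1 \<Longrightarrow> W (u * z) = W z"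
  shows "(\<integral>\<^sup>+z. ennreal ((cmod (f z))\<^sup>2) * W z \<partial>lborel)
    = (\<Sum>n. ennreal ((cmod (a n))\<^sup>2) * (\<integral>\<^sup>+z. ennreal (cmod z ^ (2 * n)) * W z \<partial>lborel))"
proof -
  have [measurable]: "f \<in> borel_measurable borel"
    using f by (intro borel_measurable_continuous_onI holomorphic_on_imp_continuous_on)
  have [measurable]: "cis \<in> borel_measurable borel"
    by (intro borel_measurable_continuous_onI continuous_intros)
  have "(\<integral>\<^sup>+z. ennreal ((cmod (f z))\<^sup>2) * W z \<partial>lborel) =
      (\<integral>\<^sup>+t. (\<integral>\<^sup>+z. ennreal ((cmod (f z))\<^sup>2) * W z \<partial>lborel) * indicator {0..1::real} t \<partial>lborel)"
    by (simp add: nn_integral_cmult)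
  also have "\<dots> = (\<integral>\<^sup>+t. \<integral>\<^sup>+z. ennreal ((cmod (f (cis (2 * pi * t) * z)))\<^sup>2) * W z * indicator {0..1::real} t \<partial>lborel \<partial>lborel)"
  proof (rule nn_integral_cong)
    fix t :: real
    have "(\<integral>\<^sup>+z. ennreal ((cmod (f z))\<^sup>2) * W z \<partial>lborel) =
        (\<integral>\<^sup>+z. ennreal ((cmod (f (cis (2 * pi * t) * z)))\<^sup>2) * W z \<partial>lborel)"
      using nn_integral_rotate[of "\<lambda>z. ennreal ((cmod (f z))\<^sup>2) * W z" "cis (2 * pi * t)"]
      by (simp add: radial)
    then show "(\<integral>\<^sup>+z. ennreal ((cmod (f z))\<^sup>2) * W z \<partial>lborel) * indicator {0..1::real} t =
        (\<integral>\<^sup>+z. ennreal ((cmod (f (cis (2 * pi * t) * z)))\<^sup>2) * W z * indicator {0..1::real} t \<partial>lborel)"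
      by (simp add: nn_integral_multc)
  qed
  also have "\<dots> = (\<integral>\<^sup>+z. \<integral>\<^sup>+t. ennreal ((cmod (f (cis (2 * pi * t) * z)))\<^sup>2) * W z * indicator {0..1::real} t \<partial>lborel \<partial>lborel)"
    by (rule lborel_pair.Fubini') simp
  also have "\<dots> = (\<integral>\<^sup>+z. (\<Sum>n. ennreal ((cmod (a n))\<^sup>2 * cmod z ^ (2 * n)) * W z) \<partial>lborel)"
  proof (rule nn_integral_cong)
    fix z
    have "(\<integral>\<^sup>+t. ennreal ((cmod (f (cis (2 * pi * t) * z)))\<^sup>2) * W z * indicator {0..1::real} t \<partial>lborel) =
      (\<integral>\<^sup>+t. ennreal ((cmod (f (cis (2 * pi * t) * z)))\<^sup>2) * indicator {0..1::real} t \<partial>lborel) * W z"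
      by (subst nn_integral_multc[symmetric]) (auto simp: mult_ac)
    then show "(\<integral>\<^sup>+t. ennreal ((cmod (f (cis (2 * pi * t) * z)))\<^sup>2) * W z * indicator {0..1::real} t \<partial>lborel) =
       (\<Sum>n. ennreal ((cmod (a n))\<^sup>2 * cmod z ^ (2 * n)) * W z)"
      by (simp add: circle_parseval[OF a])
  qed
  also have "\<dots> = (\<Sum>n. \<integral>\<^sup>+z. ennreal ((cmod (a n))\<^sup>2 * cmod z ^ (2 * n)) * W z \<partial>lborel)"
    by (rule nn_integral_suminf) simp
  also have "\<dots> = (\<Sum>n. ennreal ((cmod (a n))\<^sup>2) * (\<integral>\<^sup>+z. ennreal (cmod z ^ (2 * n)) * W z \<partial>lborel))"
    by (simp add: ennreal_mult mult.assoc nn_integral_cmult)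
  finally show ?thesis .
qed

section \<open>Moments of Macdonald weights\<close>

lemma borel_measurable_cosh [measurable (raw)]:
  fixes f :: "'a \<Rightarrow> real"
  assumes "f \<in> borel_measurable M"
  shows "(\<lambda>x. cosh (f x)) \<in> borel_measurable M"
  using measurable_compose[OF assms, of cosh borel]
  by (simp add: borel_measurable_continuous_onI continuous_intros)

lemma cosh_le_exp_abs: "cosh (x::real) \<le> exp \<bar>x\<bar>"
  by (cases "x \<ge> 0") (simp_all add: cosh_field_def)

lemma exp_abs_le_cosh: "exp \<bar>x\<bar> \<le> 2 * cosh (x::real)"
  by (cases "x \<ge> 0") (simp_all add: cosh_field_def)

lemma nn_integral_exp_decay:
  fixes a :: real
  assumes "a > 0"
  shows "(\<integral>\<^sup>+u. ennreal (exp (- a * u)) * indicator {0..} u \<partial>lborel) < \<infinity>"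
  using nn_integral_has_integral_lebesgue'[OF _ has_integral_exp_minus_to_infinity[OF assms, of 0]] by simp

text \<open>Integrability ensures that the Bochner integral in \<open>macdonald\<close> is not the
  default value 0 of a divergent one; in the nonnegative form Tonelli can be applied to it.\<close>

lemma macdonald_nn_integral:
  assumes x: "x > 0"
  shows "ennreal (macdonald \<alpha> x) =
    (\<integral>\<^sup>+u. ennreal (exp (- x * cosh u) * cosh (\<alpha> * u)) * indicator {0..} u \<partial>lborel)"
    and "macdonald \<alpha> x \<ge> 0"
proof -
  define A where "A = \<bar>\<alpha>\<bar> + 1"
  \<comment> \<open>\<open>2 cosh u \<ge> e\<^sup>u \<ge> u\<^sup>2/4\<close>, and completing the square absorbs the linear growth of the exponent.\<close>
  have bound: "exp (- x * cosh u) * cosh (\<alpha> * u) \<le> exp (2 * A\<^sup>2 / x) * exp (- 1 * u)" if u: "u \<ge> 0" for u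
  proof -
    have "u\<^sup>2 / 4 \<le> (1 + u / 2)\<^sup>2" using u by (simp add: power2_eq_square algebra_simps)
    also have "\<dots> \<le> (exp (u / 2))\<^sup>2" using u by (intro power_mono exp_ge_add_one_self) auto
    also have "\<dots> = exp u" by (simp add: power2_eq_square flip: exp_add)
    also have "\<dots> \<le> 2 * cosh u" using exp_abs_le_cosh[of u] u by simp
    finally have "x * (u\<^sup>2 / 8) \<le> x * cosh u" using x by (intro mult_left_mono) auto
    moreover have "2 * A\<^sup>2 / x - A * u + x * (u\<^sup>2 / 8) = x / 8 * (u - 4 * A / x)\<^sup>2"
      using x by (simp add: power2_eq_square field_simps)
    moreover have "x / 8 * (u - 4 * A / x)\<^sup>2 \<ge> 0" using x by simp
    ultimately have *: "- x * cosh u + \<bar>\<alpha>\<bar> * u \<le> 2 * A\<^sup>2 / x + (- 1 * u)"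
      unfolding A_def by (simp add: algebra_simps)
    have "cosh (\<alpha> * u) \<le> exp (\<bar>\<alpha>\<bar> * u)"
      using cosh_le_exp_abs[of "\<alpha> * u"] u by (simp add: abs_mult)
    then have "exp (- x * cosh u) * cosh (\<alpha> * u) \<le> exp (- x * cosh u + \<bar>\<alpha>\<bar> * u)"
      unfolding exp_add by (rule mult_left_mono) simp
    also have "\<dots> \<le> exp (2 * A\<^sup>2 / x + (- 1 * u))" using * by simp
    finally show ?thesis unfolding exp_add .
  qed
  let ?g = "\<lambda>u. indicator {0..} u *\<^sub>R (exp (- x * cosh u) * cosh (\<alpha> * u))"
  have eq: "ennreal (?g u) = ennreal (exp (- x * cosh u) * cosh (\<alpha> * u)) * indicator {0..} u" for u
    by (auto simp: indicator_def)
  have "(\<integral>\<^sup>+u. ennreal (?g u) \<partial>lborel) \<le>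
      (\<integral>\<^sup>+u. ennreal (exp (2 * A\<^sup>2 / x)) * (ennreal (exp (- 1 * u)) * indicator {0..} u) \<partial>lborel)"
    using bound by (intro nn_integral_mono) (auto simp: indicator_def simp flip: ennreal_mult)
  also have "\<dots> < \<infinity>"
    using nn_integral_exp_decay[of 1] by (simp add: nn_integral_cmult ennreal_mult_less_top)
  finally have "integrable lborel ?g"
    by (intro integrableI_nonneg) (auto simp: indicator_def)
  from nn_integral_eq_integral[OF this]
  show "ennreal (macdonald \<alpha> x) =
    (\<integral>\<^sup>+u. ennreal (exp (- x * cosh u) * cosh (\<alpha> * u)) * indicator {0..} u \<partial>lborel)"
    unfolding eq by (simp add: macdonald_def set_lebesgue_integral_def)
  show "macdonald \<alpha> x \<ge> 0"
    unfolding macdonald_def set_lebesgue_integral_def by (intro integral_nonneg_AE) auto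
qed

lemma borel_measurable_macdonald [measurable]: "macdonald \<alpha> \<in> borel_measurable borel"
  unfolding macdonald_def set_lebesgue_integral_def by measurable

text \<open>The order enters only through \<open>cosh (\<alpha> * u)\<close>, which increases with
  |\<alpha>|. As |\<mu> - 1/2| \<le> \<mu> + 1/2 for \<mu> \<ge> 0, the even density is at most the
  odd one.\<close>

lemma macdonald_mono:
  assumes "x > 0" "\<bar>\<alpha>\<bar> \<le> \<bar>\<beta>\<bar>"
  shows "macdonald \<alpha> x \<le> macdonald \<beta> x"
proof -
  have c: "cosh (\<alpha> * u) \<le> cosh (\<beta> * u)" for u
  proof -
    have "cosh \<bar>\<alpha> * u\<bar> \<le> cosh \<bar>\<beta> * u\<bar>"
      using assms(2) by (subst cosh_real_nonneg_le_iff) (auto simp: abs_mult intro!: mult_right_mono)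
    then show ?thesis by simp
  qed
  have "ennreal (macdonald \<alpha> x) \<le> ennreal (macdonald \<beta> x)"
    unfolding macdonald_nn_integral(1)[OF assms(1)]
    by (intro nn_integral_mono mult_right_mono ennreal_leI mult_left_mono c) auto
  then show ?thesis using macdonald_nn_integral(2)[OF assms(1)] by (simp add: ennreal_le_iff)
qed

text \<open>In the variable x = |z|^2 this is Euler's integral for Gamma, rescaled by
  \<open>t\<close>.\<close>

lemma nn_integral_gaussian_moment:
  assumes s: "s \<ge> 0" and t: "t > 0"
  shows "(\<integral>\<^sup>+z. ennreal (cmod z powr (2 * s) * exp (- t * (cmod z)\<^sup>2)) \<partial>lborel)
    = ennreal (pi * Gamma (s + 1) * t powr - (s + 1))"
proof -
  let ?I = "\<integral>\<^sup>+x. ennreal (x powr s * exp (- t * x)) * indicator {0..} x \<partial>lborel"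
  have "ennreal (Gamma (s + 1)) = (\<integral>\<^sup>+x. ennreal (x powr s / exp x) * indicator {0..} x \<partial>lborel)"
    using nn_integral_has_integral_lebesgue'[OF _ Gamma_integral_real[of "s + 1"]] s by simp
  also have "\<dots> = ennreal t * (\<integral>\<^sup>+x. ennreal ((t * x) powr s / exp (t * x)) * indicator {0..} (t * x) \<partial>lborel)"
    using t by (subst nn_integral_real_affine[where c = t and t = 0]) auto
  also have "(\<integral>\<^sup>+x. ennreal ((t * x) powr s / exp (t * x)) * indicator {0..} (t * x) \<partial>lborel) =
      (\<integral>\<^sup>+x. ennreal (t powr s) * (ennreal (x powr s * exp (- t * x)) * indicator {0..} x) \<partial>lborel)"
    using t by (intro nn_integral_cong)
      (auto simp: indicator_def powr_mult exp_minus field_simps zero_le_mult_iff simp flip: ennreal_mult)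
  also have "\<dots> = ennreal (t powr s) * ?I"
    by (rule nn_integral_cmult) measurable
  finally have "ennreal (Gamma (s + 1)) = ennreal (t powr (s + 1)) * ?I"
    using t by (simp add: powr_add ennreal_mult mult_ac)
  then have "ennreal (t powr - (s + 1)) * ennreal (Gamma (s + 1)) = ennreal (t powr - (s + 1)) * ennreal (t powr (s + 1)) * ?I"
    by (simp add: mult.assoc)
  also have "ennreal (t powr - (s + 1)) * ennreal (t powr (s + 1)) = 1"
    using t by (simp flip: ennreal_mult powr_add)
  finally have I: "?I = ennreal (t powr - (s + 1) * Gamma (s + 1))"
    using s by (simp add: ennreal_mult)
  have "cmod z powr (2 * s) = ((cmod z)\<^sup>2) powr s" for z
    by (simp add: powr_powr[symmetric])
  then have "(\<integral>\<^sup>+z. ennreal (cmod z powr (2 * s) * exp (- t * (cmod z)\<^sup>2)) \<partial>lborel) = ennreal pi * ?I"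
    by (simp only:) (rule nn_integral_cmod_square[of "\<lambda>x. ennreal (x powr s * exp (- t * x))"], measurable)
  also have "\<dots> = ennreal (pi * Gamma (s + 1) * t powr - (s + 1))"
    unfolding I using s by (simp add: mult_ac flip: ennreal_mult)
  finally show ?thesis .
qed

section \<open>Integrals of cosh quotients\<close>

text \<open>The factor of a Macdonald moment that carries the order; it is infinite when |\<alpha>|
  \<ge> \<sigma>, hence the values in \<open>ennreal\<close>.\<close>

definition cosh_integral :: "real \<Rightarrow> real \<Rightarrow> ennreal" where
  "cosh_integral \<alpha> \<sigma> = (\<integral>\<^sup>+u. ennreal (cosh (\<alpha> * u) * cosh u powr - \<sigma>) * indicator {0..} u \<partial>lborel)"

lemma cosh_integral_antimono: "\<sigma> \<le> \<sigma>' \<Longrightarrow> cosh_integral \<alpha> \<sigma>' \<le> cosh_integral \<alpha> \<sigma>"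
  unfolding cosh_integral_def
  by (intro nn_integral_mono mult_right_mono ennreal_leI mult_left_mono powr_mono) (auto simp: cosh_real_ge_1)

text \<open>Only [0,1] is kept; there cosh u \<le> cosh 1 and the numerator is at least 1, which
  makes the bound independent of \<alpha>.\<close>

lemma cosh_integral_lower:
  assumes "\<sigma> \<ge> 0"
  shows "ennreal (cosh 1 powr - \<sigma>) \<le> cosh_integral \<alpha> \<sigma>"
proof -
  have "ennreal (cosh 1 powr - \<sigma>) = (\<integral>\<^sup>+u. ennreal (cosh 1 powr - \<sigma>) * indicator {0..1::real} u \<partial>lborel)"
    by (simp add: nn_integral_cmult)
  also have "\<dots> \<le> cosh_integral \<alpha> \<sigma>"
    unfolding cosh_integral_def
  proof (rule nn_integral_mono)
    fix u :: real
    have "1 * cosh 1 powr - \<sigma> \<le> cosh (\<alpha> * u) * cosh u powr - \<sigma>" if "u \<in> {0..1}"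
      using that assms by (intro mult_mono powr_mono2') (auto simp: cosh_real_ge_1 cosh_real_nonneg_le_iff)
    then show "ennreal (cosh 1 powr - \<sigma>) * indicator {0..1} u
        \<le> ennreal (cosh (\<alpha> * u) * cosh u powr - \<sigma>) * indicator {0..} u"
      by (auto simp: indicator_def)
  qed
  finally show ?thesis .
qed

text \<open>From cosh (\<beta> u) \<le> exp (|\<beta>| u) and cosh u \<ge> exp u / 2 the integrand
  decays at the rate \<sigma> - |\<beta>| > 0.\<close>

lemma cosh_integral_finite:
  assumes "\<bar>\<beta>\<bar> < \<sigma>"
  shows "cosh_integral \<beta> \<sigma> < \<infinity>"
proof -
  have bound: "cosh (\<beta> * u) * cosh u powr - \<sigma> \<le> 2 powr \<sigma> * exp (- (\<sigma> - \<bar>\<beta>\<bar>) * u)" if u: "u \<ge> 0" for u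
  proof -
    have "cosh (\<beta> * u) \<le> exp (\<bar>\<beta>\<bar> * u)"
      using cosh_le_exp_abs[of "\<beta> * u"] u by (simp add: abs_mult)
    moreover have "cosh u powr - \<sigma> \<le> (exp u / 2) powr - \<sigma>"
      using exp_abs_le_cosh[of u] u assms by (intro powr_mono2') auto
    ultimately have "cosh (\<beta> * u) * cosh u powr - \<sigma> \<le> exp (\<bar>\<beta>\<bar> * u) * (exp u / 2) powr - \<sigma>"
      by (intro mult_mono) auto
    also have "\<dots> = 2 powr \<sigma> * exp (- (\<sigma> - \<bar>\<beta>\<bar>) * u)"
      by (simp add: powr_divide powr_minus exp_powr_real exp_minus exp_diff field_simps)
    finally show ?thesis .
  qed
  have "cosh_integral \<beta> \<sigma> \<le>
      (\<integral>\<^sup>+u. ennreal (2 powr \<sigma>) * (ennreal (exp (- (\<sigma> - \<bar>\<beta>\<bar>) * u)) * indicator {0..} u) \<partial>lborel)"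
    unfolding cosh_integral_def using bound
    by (intro nn_integral_mono) (auto simp: indicator_def simp flip: ennreal_mult)
  also have "\<dots> < \<infinity>"
    using nn_integral_exp_decay[of "\<sigma> - \<bar>\<beta>\<bar>"] assms by (simp add: nn_integral_cmult ennreal_mult_less_top)
  finally show ?thesis .
qed

lemma cosh_integral_compare:
  assumes "\<bar>\<beta>\<bar> < \<sigma>\<^sub>0"
  shows "\<exists>R > 0. \<forall>\<sigma> \<ge> \<sigma>\<^sub>0. cosh_integral \<beta> \<sigma> \<le> ennreal R * cosh_integral \<alpha> \<sigma>"
proof -
  have \<sigma>\<^sub>0: "\<sigma>\<^sub>0 \<ge> 0" using assms by simp
  define F where "F = enn2real (cosh_integral \<beta> \<sigma>\<^sub>0)"
  have F: "cosh_integral \<beta> \<sigma>\<^sub>0 = ennreal F" "F \<ge> 0"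
    using cosh_integral_finite[OF assms] by (auto simp: F_def)
  \<comment> \<open>The first summand pays for [0,1] and the second for the tail. The constant must
    not depend on \<sigma>, since it has to serve all moments at once.\<close>
  let ?R = "cosh \<beta> + F * cosh 1 powr \<sigma>\<^sub>0"
  have "cosh_integral \<beta> \<sigma> \<le> ennreal ?R * cosh_integral \<alpha> \<sigma>" if \<sigma>: "\<sigma> \<ge> \<sigma>\<^sub>0" for \<sigma>
  proof -
    \<comment> \<open>On \<open>[0,1]\<close> the numerators are comparable; beyond \<open>1\<close> the integrand for \<open>\<sigma>\<close> is at most \<open>(cosh 1)\<close> to the
      power \<open>\<sigma>\<^sub>0 - \<sigma>\<close> times that for \<open>\<sigma>\<^sub>0\<close>, which the lower bound \<open>cosh_integral_lower\<close> matches.\<close>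
    let ?f = "\<lambda>\<alpha> \<sigma> u. ennreal (cosh (\<alpha> * u) * cosh u powr - \<sigma>) * indicator {0..} u"
    have pw: "?f \<beta> \<sigma> u \<le> ennreal (cosh \<beta>) * ?f \<alpha> \<sigma> u + ennreal (cosh 1 powr (\<sigma>\<^sub>0 - \<sigma>)) * ?f \<beta> \<sigma>\<^sub>0 u" for u
    proof (cases "u \<ge> 0")
      case u: True
      show ?thesis
      proof (cases "u \<le> 1")
        case True
        have "cosh \<bar>\<beta> * u\<bar> \<le> cosh \<bar>\<beta>\<bar>"
          using True u by (subst cosh_real_nonneg_le_iff) (auto simp: abs_mult intro!: mult_left_le)
        then have "cosh (\<beta> * u) * 1 \<le> cosh \<beta> * cosh (\<alpha> * u)"
          by (intro mult_mono) (auto simp: cosh_real_ge_1)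
        then have "cosh (\<beta> * u) * cosh u powr - \<sigma> \<le> cosh \<beta> * cosh (\<alpha> * u) * cosh u powr - \<sigma>"
          by (intro mult_right_mono) auto
        then have "?f \<beta> \<sigma> u \<le> ennreal (cosh \<beta>) * ?f \<alpha> \<sigma> u"
          using u by (auto simp: indicator_def mult.assoc simp flip: ennreal_mult)
        then show ?thesis by (rule order_trans) simp
      next
        case False
        have "cosh u powr - \<sigma> = cosh u powr (\<sigma>\<^sub>0 - \<sigma>) * cosh u powr - \<sigma>\<^sub>0"
          by (simp flip: powr_add)
        also have "\<dots> \<le> cosh 1 powr (\<sigma>\<^sub>0 - \<sigma>) * cosh u powr - \<sigma>\<^sub>0"
          using False \<sigma> by (intro mult_right_mono powr_mono2') (auto simp: cosh_real_nonneg_le_iff)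
        finally have "cosh (\<beta> * u) * cosh u powr - \<sigma> \<le> cosh 1 powr (\<sigma>\<^sub>0 - \<sigma>) * (cosh (\<beta> * u) * cosh u powr - \<sigma>\<^sub>0)"
          using mult_left_mono[of _ _ "cosh (\<beta> * u)"] by (simp add: mult_ac)
        then have "?f \<beta> \<sigma> u \<le> ennreal (cosh 1 powr (\<sigma>\<^sub>0 - \<sigma>)) * ?f \<beta> \<sigma>\<^sub>0 u"
          using u by (auto simp: indicator_def simp flip: ennreal_mult)
        then show ?thesis by (rule order_trans) simp
      qed
    qed simp
    have "cosh_integral \<beta> \<sigma> \<le> (\<integral>\<^sup>+u. ennreal (cosh \<beta>) * ?f \<alpha> \<sigma> u + ennreal (cosh 1 powr (\<sigma>\<^sub>0 - \<sigma>)) * ?f \<beta> \<sigma>\<^sub>0 u \<partial>lborel)"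
      unfolding cosh_integral_def by (intro nn_integral_mono pw)
    also have "\<dots> = ennreal (cosh \<beta>) * cosh_integral \<alpha> \<sigma> + ennreal (cosh 1 powr (\<sigma>\<^sub>0 - \<sigma>)) * ennreal F"
      by (simp add: nn_integral_add nn_integral_cmult F(1)[unfolded cosh_integral_def] cosh_integral_def)
    also have "ennreal (cosh 1 powr (\<sigma>\<^sub>0 - \<sigma>)) * ennreal F = ennreal (F * cosh 1 powr \<sigma>\<^sub>0) * ennreal (cosh 1 powr - \<sigma>)"
      using F(2) by (simp add: mult_ac flip: ennreal_mult powr_add)
    also have "\<dots> \<le> ennreal (F * cosh 1 powr \<sigma>\<^sub>0) * cosh_integral \<alpha> \<sigma>"
      using \<sigma> \<sigma>\<^sub>0 by (intro mult_left_mono cosh_integral_lower) auto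
    finally show ?thesis
      using F(2) by (simp add: distrib_right ennreal_plus)
  qed
  moreover have "?R > 0" using F(2) by (intro add_pos_nonneg) auto
  ultimately show ?thesis by blast
qed

section \<open>Growth and comparison of the moments\<close>

text \<open>Each step of the recursion multiplies Gamma by n + x \<ge> n + 1. The factorial is what
  later produces an exponential series.\<close>

lemma Gamma_add_nat_ge_fact:
  assumes "(x::real) \<ge> 1"
  shows "Gamma x * fact n \<le> Gamma (real n + x)"
proof (induction n)
  case (Suc n)
  have gamma: "Gamma (real n + x + 1) = (real n + x) * Gamma (real n + x)"
    using assms by (intro Gamma_plus1) auto
  have "Gamma x * fact (Suc n) = real (Suc n) * (Gamma x * fact n)" by (simp add: algebra_simps)
  also have "\<dots> \<le> (real n + x) * Gamma (real n + x)"
    using assms Suc by (intro mult_mono) auto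
  also have "\<dots> = Gamma (real (Suc n) + x)"
    using gamma by (simp add: add_ac)
  finally show ?case .
qed simp

text \<open>Common form of both densities: they share \<open>c\<close> and \<tau> = \<mu> + 1/2 and
  differ only in the order, \<mu> - 1/2 for the even and \<mu> + 1/2 for the odd one.\<close>

definition macdonald_weight :: "real \<Rightarrow> real \<Rightarrow> real \<Rightarrow> complex \<Rightarrow> ennreal" where
  "macdonald_weight c \<tau> \<alpha> z = ennreal (c * macdonald \<alpha> ((cmod z)\<^sup>2) * cmod z powr (2 * \<tau>))"

definition macdonald_moment :: "real \<Rightarrow> real \<Rightarrow> real \<Rightarrow> nat \<Rightarrow> ennreal" where
  "macdonald_moment c \<tau> \<alpha> n = (\<integral>\<^sup>+z. ennreal (cmod z ^ (2 * n)) * macdonald_weight c \<tau> \<alpha> z \<partial>lborel)"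

lemma borel_measurable_macdonald_weight [measurable]: "macdonald_weight c \<tau> \<alpha> \<in> borel_measurable borel"
  unfolding macdonald_weight_def by measurable

lemma macdonald_weight_mono:
  assumes "c \<ge> 0" "\<bar>\<alpha>\<bar> \<le> \<bar>\<beta>\<bar>"
  shows "macdonald_weight c \<tau> \<alpha> z \<le> macdonald_weight c \<tau> \<beta> z"
proof (cases "z = 0")
  case False
  then show ?thesis unfolding macdonald_weight_def
    using assms by (intro ennreal_leI mult_right_mono mult_left_mono macdonald_mono) auto
qed (simp add: macdonald_weight_def)

text \<open>Once \<open>macdonald\<close> is written as an integral over \<open>u\<close> and the
  integrals are exchanged, the inner one is a Gaussian moment with rate
  \<open>cosh u\<close>.\<close>

lemma macdonald_moment_eq:
  assumes "c > 0" "\<tau> \<ge> 0"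
  shows "macdonald_moment c \<tau> \<alpha> n =
    ennreal (c * pi * Gamma (real n + \<tau> + 1)) * cosh_integral \<alpha> (real n + \<tau> + 1)"
proof -
  let ?h = "\<lambda>z u. ennreal (c * cosh (\<alpha> * u)) * indicator {0..} u
    * ennreal (cmod z powr (2 * (real n + \<tau>)) * exp (- cosh u * (cmod z)\<^sup>2))"
  have "ennreal (cmod z ^ (2 * n)) * macdonald_weight c \<tau> \<alpha> z = (\<integral>\<^sup>+u. ?h z u \<partial>lborel)" for z
  proof (cases "z = 0")
    case False
    then have z: "(cmod z)\<^sup>2 > 0" by simp
    have p: "cmod z powr (2 * (real n + \<tau>)) = cmod z ^ (2 * n) * cmod z powr (2 * \<tau>)"
      using False by (simp add: powr_realpow[symmetric] powr_add[symmetric] algebra_simps)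
    have "ennreal (cmod z ^ (2 * n)) * macdonald_weight c \<tau> \<alpha> z =
        ennreal (c * cmod z powr (2 * (real n + \<tau>))) * ennreal (macdonald \<alpha> ((cmod z)\<^sup>2))"
      unfolding macdonald_weight_def p using macdonald_nn_integral(2)[OF z] assms
      by (simp add: mult_ac flip: ennreal_mult)
    also have "\<dots> = (\<integral>\<^sup>+u. ennreal (c * cmod z powr (2 * (real n + \<tau>))) *
        (ennreal (exp (- (cmod z)\<^sup>2 * cosh u) * cosh (\<alpha> * u)) * indicator {0..} u) \<partial>lborel)"
      unfolding macdonald_nn_integral(1)[OF z] by (rule nn_integral_cmult[symmetric]) measurable
    also have "\<dots> = (\<integral>\<^sup>+u. ?h z u \<partial>lborel)"
      using assms by (intro nn_integral_cong) (auto simp: indicator_def mult_ac simp flip: ennreal_mult)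
    finally show ?thesis .
  qed (simp add: macdonald_weight_def)
  then have "macdonald_moment c \<tau> \<alpha> n = (\<integral>\<^sup>+z. \<integral>\<^sup>+u. ?h z u \<partial>lborel \<partial>lborel)"
    by (simp add: macdonald_moment_def)
  also have "\<dots> = (\<integral>\<^sup>+u. \<integral>\<^sup>+z. ?h z u \<partial>lborel \<partial>lborel)"
    by (rule lborel_pair.Fubini') measurable
  also have "\<dots> = (\<integral>\<^sup>+u. ennreal (c * cosh (\<alpha> * u)) * indicator {0..} u *
      ennreal (pi * Gamma (real n + \<tau> + 1) * cosh u powr - (real n + \<tau> + 1)) \<partial>lborel)"
  proof (rule nn_integral_cong)
    fix u :: real
    show "(\<integral>\<^sup>+z. ?h z u \<partial>lborel) = ennreal (c * cosh (\<alpha> * u)) * indicator {0..} u *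
      ennreal (pi * Gamma (real n + \<tau> + 1) * cosh u powr - (real n + \<tau> + 1))"
      using assms by (subst nn_integral_cmult) (measurable, simp only: nn_integral_gaussian_moment[of "real n + \<tau>" "cosh u"] cosh_real_pos add_nonneg_nonneg of_nat_0_le_iff)
  qed
  also have "\<dots> = (\<integral>\<^sup>+u. ennreal (c * pi * Gamma (real n + \<tau> + 1)) *
      (ennreal (cosh (\<alpha> * u) * cosh u powr - (real n + \<tau> + 1)) * indicator {0..} u) \<partial>lborel)"
    using assms by (intro nn_integral_cong) (auto simp: indicator_def mult_ac simp flip: ennreal_mult)
  also have "\<dots> = ennreal (c * pi * Gamma (real n + \<tau> + 1)) * cosh_integral \<alpha> (real n + \<tau> + 1)"
    unfolding cosh_integral_def by (rule nn_integral_cmult) measurable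
  finally show ?thesis .
qed

text \<open>Gamma contributes the factor n + \<tau> + 1 \<le> (\<tau> + 1) (n + 1), while the cosh
  integral decreases in \<sigma>.\<close>

lemma macdonald_moment_Suc:
  assumes "c > 0" "\<tau> \<ge> 0"
  shows "macdonald_moment c \<tau> \<alpha> (Suc n) \<le> ennreal ((\<tau> + 1) * real (Suc n)) * macdonald_moment c \<tau> \<alpha> n"
proof -
  let ?x = "real n + \<tau> + 1"
  have g: "Gamma (?x + 1) = ?x * Gamma ?x" using assms by (intro Gamma_plus1) auto
  have e: "real (Suc n) + \<tau> + 1 = ?x + 1" by simp
  have "macdonald_moment c \<tau> \<alpha> (Suc n) = ennreal (c * pi * (?x * Gamma ?x)) * cosh_integral \<alpha> (?x + 1)"
    by (simp only: macdonald_moment_eq[OF assms] e g)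
  also have "\<dots> \<le> ennreal ((\<tau> + 1) * real (Suc n) * (c * pi * Gamma ?x)) * cosh_integral \<alpha> ?x"
  proof -
    have "?x \<le> (\<tau> + 1) * real (Suc n)" using assms by (simp add: algebra_simps)
    then have "?x * (c * pi * Gamma ?x) \<le> (\<tau> + 1) * real (Suc n) * (c * pi * Gamma ?x)"
      using assms by (intro mult_right_mono) auto
    then have "c * pi * (?x * Gamma ?x) \<le> (\<tau> + 1) * real (Suc n) * (c * pi * Gamma ?x)"
      by (simp add: mult_ac)
    then show ?thesis
      by (rule mult_mono[OF ennreal_leI cosh_integral_antimono]) auto
  qed
  also have "\<dots> = ennreal ((\<tau> + 1) * real (Suc n)) * macdonald_moment c \<tau> \<alpha> n"
    unfolding macdonald_moment_eq[OF assms] using assms by (subst ennreal_mult) (auto simp: mult.assoc)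
  finally show ?thesis .
qed

text \<open>The lower bounds for Gamma and for the cosh integral are multiplied. The shape n! / q^n
  with q = cosh 1 is chosen because its reciprocals sum against |z|^(2n) to exp (q |z|^2).\<close>

lemma macdonald_moment_lower:
  assumes "c > 0" "\<tau> \<ge> 0"
  shows "ennreal (c * pi * Gamma (\<tau> + 1) * cosh 1 powr - (\<tau> + 1) * (fact n / cosh 1 ^ n))
    \<le> macdonald_moment c \<tau> \<alpha> n"
proof -
  have "cosh (1::real) powr - (real n + \<tau> + 1) = cosh 1 powr - (\<tau> + 1) * cosh 1 powr - real n"
    unfolding powr_add[symmetric] by (simp add: algebra_simps)
  also have "cosh (1::real) powr - real n = 1 / cosh 1 ^ n"
    by (simp add: powr_minus powr_realpow field_simps)
  finally have p: "cosh (1::real) powr - (real n + \<tau> + 1) = cosh 1 powr - (\<tau> + 1) / cosh 1 ^ n" by simp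
  have g: "Gamma (\<tau> + 1) * fact n \<le> Gamma (real n + \<tau> + 1)"
    using Gamma_add_nat_ge_fact[of "\<tau> + 1" n] assms by (simp add: add_ac)
  have "ennreal (c * pi * Gamma (\<tau> + 1) * cosh 1 powr - (\<tau> + 1) * (fact n / cosh 1 ^ n)) =
      ennreal (c * pi * (Gamma (\<tau> + 1) * fact n)) * ennreal (cosh 1 powr - (real n + \<tau> + 1))"
    unfolding p using assms by (simp flip: ennreal_mult)
  also have "\<dots> \<le> macdonald_moment c \<tau> \<alpha> n"
    unfolding macdonald_moment_eq[OF assms] using assms g
    by (intro mult_mono ennreal_leI mult_left_mono cosh_integral_lower) auto
  finally show ?thesis .
qed

text \<open>Both moments have the same Gamma factor, so only the cosh integrals are compared, from
  \<sigma> = \<tau> + 1 > |\<beta>| on.\<close>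

lemma macdonald_moment_compare:
  assumes "c > 0" "\<tau> \<ge> 0" "\<bar>\<beta>\<bar> \<le> \<tau>"
  shows "\<exists>R > 0. \<forall>n. macdonald_moment c \<tau> \<beta> n \<le> ennreal R * macdonald_moment c \<tau> \<alpha> n"
proof -
  obtain R where R: "R > 0" "\<And>\<sigma>. \<sigma> \<ge> \<tau> + 1 \<Longrightarrow> cosh_integral \<beta> \<sigma> \<le> ennreal R * cosh_integral \<alpha> \<sigma>"
    using cosh_integral_compare[of \<beta> "\<tau> + 1" \<alpha>] assms by auto
  have "macdonald_moment c \<tau> \<beta> n \<le> ennreal R * macdonald_moment c \<tau> \<alpha> n" for n
    unfolding macdonald_moment_eq[OF assms(1,2)] mult.left_commute[of "ennreal R"]
    by (intro mult_left_mono R(2)) auto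
  then show ?thesis using R(1) by blast
qed

section \<open>Pointwise bounds, energy and entropy\<close>

lemma macdonald_weight_rotate: "cmod u = 1 \<Longrightarrow> macdonald_weight c \<tau> \<alpha> (u * z) = macdonald_weight c \<tau> \<alpha> z"
  by (simp add: macdonald_weight_def norm_mult)

text \<open>In HOL \<open>0 powr x = 0\<close> even for \<open>x = 0\<close>. The weight therefore
  hides the origin, where \<open>macdonald\<close> carries no information and quotients by
  \<open>z\<close> are singular.\<close>

lemma macdonald_weight_0 [simp]: "macdonald_weight c \<tau> \<alpha> 0 = 0"
  by (simp add: macdonald_weight_def)

lemma macdonald_parseval:
  assumes a: "\<And>z. (\<lambda>n. a n * z ^ n) sums f z" and f: "f holomorphic_on UNIV"
  shows "(\<integral>\<^sup>+z. ennreal ((cmod (f z))\<^sup>2) * macdonald_weight c \<tau> \<alpha> z \<partial>lborel)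
    = (\<Sum>n. ennreal ((cmod (a n))\<^sup>2) * macdonald_moment c \<tau> \<alpha> n)"
  unfolding macdonald_moment_def
  by (rule radial_parseval[OF a f]) (auto simp: macdonald_weight_rotate)

text \<open>Cauchy-Schwarz on the Taylor series with weights \<open>w n\<close>, the lower bounds of
  the moments: one factor is at most the squared norm by Parseval, the other is a partial sum of an
  exponential series.\<close>

lemma entire_pointwise_bound:
  fixes a :: "nat \<Rightarrow> complex"
  assumes a: "\<And>z. (\<lambda>n. a n * z ^ n) sums f z" and f: "f holomorphic_on UNIV"
    and c: "c > 0" and \<tau>: "\<tau> \<ge> 0"
    and N: "(\<integral>\<^sup>+z. ennreal ((cmod (f z))\<^sup>2) * macdonald_weight c \<tau> \<alpha> z \<partial>lborel) \<le> ennreal N" "N \<ge> 0"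
  shows "(cmod (f z))\<^sup>2 \<le> exp (cosh 1 * (cmod z)\<^sup>2) / (c * pi * Gamma (\<tau> + 1) * cosh 1 powr - (\<tau> + 1)) * N"
proof -
  define \<kappa> where "\<kappa> = c * pi * Gamma (\<tau> + 1) * cosh 1 powr - (\<tau> + 1)"
  have \<kappa>: "\<kappa> > 0" unfolding \<kappa>_def using c \<tau> by (intro mult_pos_pos) auto
  define w where "w n = \<kappa> * (fact n / cosh 1 ^ n)" for n :: nat
  have w: "w n > 0" for n unfolding w_def using \<kappa> by simp
  have coeff: "(\<Sum>n<k. (cmod (a n))\<^sup>2 * w n) \<le> N" for k
  proof -
    have "ennreal (\<Sum>n<k. (cmod (a n))\<^sup>2 * w n) = (\<Sum>n<k. ennreal ((cmod (a n))\<^sup>2) * ennreal (w n))"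
      using w by (simp add: less_imp_le sum_ennreal[symmetric] ennreal_mult)
    also have "\<dots> \<le> (\<Sum>n<k. ennreal ((cmod (a n))\<^sup>2) * macdonald_moment c \<tau> \<alpha> n)"
      unfolding w_def \<kappa>_def by (intro sum_mono mult_left_mono macdonald_moment_lower c \<tau>) auto
    also have "\<dots> \<le> (\<Sum>n. ennreal ((cmod (a n))\<^sup>2) * macdonald_moment c \<tau> \<alpha> n)"
      by (intro sum_le_suminf summableI) auto
    also have "\<dots> \<le> ennreal N"
      using N(1) by (simp add: macdonald_parseval[OF a f])
    finally show ?thesis using N(2) by (simp add: ennreal_le_iff)
  qed
  have part: "(\<Sum>n<k. cmod (a n * z ^ n))\<^sup>2 \<le> exp (cosh 1 * (cmod z)\<^sup>2) / \<kappa> * N" for k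
  proof -
    have "(\<Sum>n<k. cmod (a n * z ^ n))\<^sup>2 = (\<Sum>n<k. (cmod (a n) * sqrt (w n)) * (cmod z ^ n / sqrt (w n)))\<^sup>2"
      using w by (simp add: norm_mult norm_power less_imp_neq[symmetric])
    also have "\<dots> \<le> (\<Sum>n<k. (cmod (a n) * sqrt (w n))\<^sup>2) * (\<Sum>n<k. (cmod z ^ n / sqrt (w n))\<^sup>2)"
      by (rule Cauchy_Schwarz_ineq_sum)
    also have "(\<Sum>n<k. (cmod (a n) * sqrt (w n))\<^sup>2) = (\<Sum>n<k. (cmod (a n))\<^sup>2 * w n)"
      using w by (simp add: power_mult_distrib less_imp_le)
    also have "(\<Sum>n<k. (cmod z ^ n / sqrt (w n))\<^sup>2) = (\<Sum>n<k. (cosh 1 * (cmod z)\<^sup>2) ^ n /\<^sub>R fact n) / \<kappa>"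
      using w \<kappa> by (simp add: power_divide less_imp_le sum_divide_distrib)
        (simp add: w_def power_mult_distrib power_mult[symmetric] field_simps)
    also have "(\<Sum>n<k. (cmod (a n))\<^sup>2 * w n) * \<dots> \<le> N * (exp (cosh 1 * (cmod z)\<^sup>2) / \<kappa>)"
    proof (intro mult_mono divide_right_mono coeff N)
      show "(\<Sum>n<k. (cosh 1 * (cmod z)\<^sup>2) ^ n /\<^sub>R fact n) \<le> exp (cosh 1 * (cmod z)\<^sup>2)"
        unfolding exp_def by (intro sum_le_suminf summable_exp_generic) auto
    qed (use \<kappa> in \<open>auto intro!: divide_nonneg_nonneg sum_nonneg\<close>)
    finally show ?thesis by (simp add: mult_ac)
  qed
  have lim: "(\<lambda>k. (cmod (\<Sum>n<k. a n * z ^ n))\<^sup>2) \<longlonglongrightarrow> (cmod (f z))\<^sup>2"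
    using a[of z] unfolding sums_def by (intro tendsto_intros)
  have "(cmod (\<Sum>n<k. a n * z ^ n))\<^sup>2 \<le> exp (cosh 1 * (cmod z)\<^sup>2) / \<kappa> * N" for k
    by (rule order_trans[OF power_mono[OF norm_sum] part]) simp
  then show ?thesis
    unfolding \<kappa>_def[symmetric] by (intro LIMSEQ_le_const2[OF lim]) auto
qed

section \<open>Energy in terms of Taylor coefficients\<close>

lemma entire_power_series:
  assumes "f holomorphic_on UNIV"
  shows "(\<lambda>n. (deriv ^^ n) f 0 / fact n * z ^ n) sums f z"
  using holomorphic_power_series[of f 0 "cmod z + 1" z] holomorphic_on_subset[OF assms]
  by simp

text \<open>The factor |z|^2 is absorbed into the radial weight, which shifts the moments by one
  index.\<close>

lemma macdonald_energy_parseval: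
  assumes a: "\<And>z. (\<lambda>n. a n * z ^ n) sums f z" and f: "f holomorphic_on UNIV"
  shows "(\<integral>\<^sup>+z. ennreal ((cmod z)\<^sup>2 * (cmod (f z))\<^sup>2) * macdonald_weight c \<tau> \<alpha> z \<partial>lborel)
    = (\<Sum>n. ennreal ((cmod (a n))\<^sup>2) * macdonald_moment c \<tau> \<alpha> (Suc n))"
proof -
  let ?V = "\<lambda>z. ennreal ((cmod z)\<^sup>2) * macdonald_weight c \<tau> \<alpha> z"
  have mom: "(\<integral>\<^sup>+z. ennreal (cmod z ^ (2 * n)) * ?V z \<partial>lborel) = macdonald_moment c \<tau> \<alpha> (Suc n)" for n
    unfolding macdonald_moment_def
  proof (rule nn_integral_cong)
    fix z
    have "cmod z ^ (2 * Suc n) = cmod z ^ (2 * n) * (cmod z)\<^sup>2"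
      by (simp add: power2_eq_square)
    then show "ennreal (cmod z ^ (2 * n)) * ?V z = ennreal (cmod z ^ (2 * Suc n)) * macdonald_weight c \<tau> \<alpha> z"
      by (simp add: ennreal_mult mult.assoc del: mult_Suc_right power_Suc)
  qed
  have "(\<integral>\<^sup>+z. ennreal ((cmod z)\<^sup>2 * (cmod (f z))\<^sup>2) * macdonald_weight c \<tau> \<alpha> z \<partial>lborel)
      = (\<integral>\<^sup>+z. ennreal ((cmod (f z))\<^sup>2) * ?V z \<partial>lborel)"
    by (simp add: ennreal_mult mult_ac)
  also have "\<dots> = (\<Sum>n. ennreal ((cmod (a n))\<^sup>2) * (\<integral>\<^sup>+z. ennreal (cmod z ^ (2 * n)) * ?V z \<partial>lborel))"
    by (rule radial_parseval[OF a f]) (auto simp: macdonald_weight_rotate norm_mult)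
  finally show ?thesis unfolding mom .
qed

text \<open>Both sides are compared coefficient by coefficient. \<open>G\<close> is prescribed only
  off 0, so that the even or odd part of \<open>D \<mu> f\<close> can be substituted for it.\<close>

lemma macdonald_energy_le_dunkl:
  assumes f: "f holomorphic_on UNIV" and c: "c > 0" and \<tau>: "\<tau> \<ge> 0" and \<mu>: "\<mu> \<ge> 0"
    and G: "\<And>z. z \<noteq> 0 \<Longrightarrow> G z = deriv f z + of_real \<mu> / z * (f z - f (- z))"
  shows "(\<integral>\<^sup>+z. ennreal ((cmod z)\<^sup>2 * (cmod (f z))\<^sup>2) * macdonald_weight c \<tau> \<alpha> z \<partial>lborel)
    \<le> ennreal (2 * (\<tau> + 1)\<^sup>2) * (\<integral>\<^sup>+z. ennreal ((cmod (G z))\<^sup>2) * macdonald_weight c \<tau> \<alpha> z \<partial>lborel)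
      + ennreal (\<tau> + 1) * (\<integral>\<^sup>+z. ennreal ((cmod (f z))\<^sup>2) * macdonald_weight c \<tau> \<alpha> z \<partial>lborel)"
proof -
  let ?W = "macdonald_weight c \<tau> \<alpha>" and ?m = "macdonald_moment c \<tau> \<alpha>"
  define a where "a n = (deriv ^^ n) f 0 / fact n" for n
  have a: "(\<lambda>n. a n * z ^ n) sums f z" for z
    unfolding a_def by (rule entire_power_series[OF f])
  \<comment> \<open>The Dunkl operator sends z^n to \<kappa> n times z^(n-1): n for even n, n + 2
    \<mu> for odd n.\<close>
  define \<kappa> where "\<kappa> n = real n + \<mu> * (1 - (- 1) ^ n)" for n
  have \<kappa>: "\<kappa> n \<ge> real n" for n using \<mu> by (cases "even n") (auto simp: \<kappa>_def)
  \<comment> \<open>Multiplying the Dunkl operator by \<open>z\<close> avoids its singularity; the weight is divided by \<open>|z|\<^sup>2\<close> instead.\<close>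
  define h where "h z = z * deriv f z + of_real \<mu> * (f z - f (- z))" for z
  define V where "V z = ennreal (inverse ((cmod z)\<^sup>2)) * ?W z" for z
  have h_holo: "h holomorphic_on UNIV"
    unfolding h_def using f
    by (intro holomorphic_intros holomorphic_on_compose_gen[OF _ f, unfolded o_def]) auto
  have h: "(\<lambda>n. (\<kappa> n * a n) * z ^ n) sums h z" for z
  proof -
    have "(\<lambda>n. diffs a n * z ^ n) sums deriv f z"
      using a f by (intro termdiffs_sums_strong[of "cmod z + 1" a f])
        (auto intro: holomorphic_derivI)
    from sums_mult[OF this, of z] have "(\<lambda>n. of_nat (Suc n) * a (Suc n) * z ^ Suc n) sums (z * deriv f z)"
      by (simp add: diffs_def mult_ac)
    then have "(\<lambda>n. of_nat n * a n * z ^ n) sums (z * deriv f z)"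
      using sums_Suc_iff[of "\<lambda>n. of_nat n * a n * z ^ n" "z * deriv f z"] by simp
    from sums_add[OF this sums_mult[OF sums_diff[OF a[of z] a[of "- z"]], of "of_real \<mu>"]]
    show ?thesis unfolding h_def
      by (rule sums_cong[THEN iffD1, rotated]) (simp add: \<kappa>_def power_minus[of z] algebra_simps)
  qed
  have V [measurable]: "V \<in> borel_measurable borel" unfolding V_def by measurable
  have GV: "(\<integral>\<^sup>+z. ennreal ((cmod (G z))\<^sup>2) * ?W z \<partial>lborel) = (\<integral>\<^sup>+z. ennreal ((cmod (h z))\<^sup>2) * V z \<partial>lborel)"
  proof (rule nn_integral_cong)
    fix z
    show "ennreal ((cmod (G z))\<^sup>2) * ?W z = ennreal ((cmod (h z))\<^sup>2) * V z"
    proof (cases "z = 0")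
      case False
      have "h z = z * G z" using False by (simp add: h_def G field_simps)
      then have "(cmod (G z))\<^sup>2 = (cmod (h z))\<^sup>2 * inverse ((cmod z)\<^sup>2)"
        using False by (simp add: norm_mult power_mult_distrib field_simps)
      then show ?thesis by (simp add: V_def ennreal_mult mult.assoc)
    qed (simp add: V_def)
  qed
  have mV: "(\<integral>\<^sup>+z. ennreal (cmod z ^ (2 * Suc n)) * V z \<partial>lborel) = ?m n" for n
    unfolding macdonald_moment_def
  proof (rule nn_integral_cong)
    fix z
    show "ennreal (cmod z ^ (2 * Suc n)) * V z = ennreal (cmod z ^ (2 * n)) * ?W z"
    proof (cases "z = 0")
      case False
      then have "cmod z ^ (2 * n) = cmod z ^ (2 * Suc n) * inverse ((cmod z)\<^sup>2)"
        using False by (simp add: power2_eq_square field_simps)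
      then show ?thesis by (simp add: V_def ennreal_mult mult.assoc del: mult_Suc_right)
    qed (simp add: V_def)
  qed
  have termwise: "ennreal ((cmod (a n))\<^sup>2) * ?m (Suc n) \<le>
      ennreal (2 * (\<tau> + 1)\<^sup>2) * (ennreal ((cmod (\<kappa> n * a n))\<^sup>2) * (\<integral>\<^sup>+z. ennreal (cmod z ^ (2 * n)) * V z \<partial>lborel))
      + ennreal (\<tau> + 1) * (ennreal ((cmod (a n))\<^sup>2) * ?m n)" for n
  proof (cases n)
    \<comment> \<open>Constants are annihilated, as \<kappa> 0 = 0, so this coefficient is paid for
      by the norm term.\<close>
    case 0
    then show ?thesis using mult_left_mono[OF macdonald_moment_Suc[OF c \<tau>, of \<alpha> 0], of "ennreal ((cmod (a 0))\<^sup>2)"]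
      by (simp add: mult_ac \<kappa>_def)
  next
    case (Suc m)
    \<comment> \<open>The factor 2 comes from n + 1 \<le> 2 n for n \<ge> 1.\<close>
    have "(\<tau> + 1) * real (Suc n) * ((\<tau> + 1) * real n) \<le> 2 * (\<tau> + 1)\<^sup>2 * (\<kappa> n)\<^sup>2"
    proof -
      have "real (Suc n) * real n \<le> 2 * (real n)\<^sup>2"
        using Suc by (simp add: power2_eq_square algebra_simps)
      also have "\<dots> \<le> 2 * (\<kappa> n)\<^sup>2" using \<kappa>[of n] by (intro mult_left_mono power_mono) auto
      finally have "(\<tau> + 1)\<^sup>2 * (real (Suc n) * real n) \<le> (\<tau> + 1)\<^sup>2 * (2 * (\<kappa> n)\<^sup>2)"
        by (rule mult_left_mono) simp
      then show ?thesis by (simp add: power2_eq_square mult_ac)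
    qed
    then have "(cmod (a n))\<^sup>2 * ((\<tau> + 1) * real (Suc n) * ((\<tau> + 1) * real n)) \<le> (cmod (a n))\<^sup>2 * (2 * (\<tau> + 1)\<^sup>2 * (\<kappa> n)\<^sup>2)"
      by (rule mult_left_mono) simp
    also have "\<dots> = 2 * (\<tau> + 1)\<^sup>2 * (cmod (\<kappa> n * a n))\<^sup>2"
      by (simp add: norm_mult power_mult_distrib)
    finally have coef: "(cmod (a n))\<^sup>2 * ((\<tau> + 1) * real (Suc n) * ((\<tau> + 1) * real n)) \<le> 2 * (\<tau> + 1)\<^sup>2 * (cmod (\<kappa> n * a n))\<^sup>2" .
    \<comment> \<open>The recursion is used twice, since the operator lowers the degree to m = n - 1
      while the energy raises it to n + 1.\<close>
    have "?m (Suc n) \<le> ennreal ((\<tau> + 1) * real (Suc n)) * (ennreal ((\<tau> + 1) * real n) * ?m m)"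
      using macdonald_moment_Suc[OF c \<tau>, of \<alpha> m] Suc
      by (intro order_trans[OF macdonald_moment_Suc[OF c \<tau>]] mult_left_mono) auto
    then have "ennreal ((cmod (a n))\<^sup>2) * ?m (Suc n) \<le>
        ennreal ((cmod (a n))\<^sup>2) * (ennreal ((\<tau> + 1) * real (Suc n)) * (ennreal ((\<tau> + 1) * real n) * ?m m))"
      by (rule mult_left_mono) simp
    also have "\<dots> = ennreal ((cmod (a n))\<^sup>2 * ((\<tau> + 1) * real (Suc n) * ((\<tau> + 1) * real n))) * ?m m"
      using \<tau> by (simp add: ennreal_mult mult.assoc del: of_nat_Suc)
    also have "\<dots> \<le> ennreal (2 * (\<tau> + 1)\<^sup>2 * (cmod (\<kappa> n * a n))\<^sup>2) * ?m m"
      by (intro mult_right_mono ennreal_leI coef) auto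
    also have "\<dots> = ennreal (2 * (\<tau> + 1)\<^sup>2) * (ennreal ((cmod (\<kappa> n * a n))\<^sup>2) * (\<integral>\<^sup>+z. ennreal (cmod z ^ (2 * n)) * V z \<partial>lborel))"
      unfolding Suc mV by (subst ennreal_mult) (auto simp: mult.assoc)
    finally show ?thesis by (rule order_trans) simp
  qed
  have "(\<integral>\<^sup>+z. ennreal ((cmod z)\<^sup>2 * (cmod (f z))\<^sup>2) * ?W z \<partial>lborel) = (\<Sum>n. ennreal ((cmod (a n))\<^sup>2) * ?m (Suc n))"
    by (rule macdonald_energy_parseval[OF a f])
  also have "\<dots> \<le> (\<Sum>n. ennreal (2 * (\<tau> + 1)\<^sup>2) * (ennreal ((cmod (\<kappa> n * a n))\<^sup>2) * (\<integral>\<^sup>+z. ennreal (cmod z ^ (2 * n)) * V z \<partial>lborel))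
      + ennreal (\<tau> + 1) * (ennreal ((cmod (a n))\<^sup>2) * ?m n))"
    by (intro suminf_le termwise summableI)
  also have "\<dots> = ennreal (2 * (\<tau> + 1)\<^sup>2) * (\<Sum>n. ennreal ((cmod (\<kappa> n * a n))\<^sup>2) * (\<integral>\<^sup>+z. ennreal (cmod z ^ (2 * n)) * V z \<partial>lborel))
      + ennreal (\<tau> + 1) * (\<Sum>n. ennreal ((cmod (a n))\<^sup>2) * ?m n)"
    by (simp add: suminf_add[symmetric] summableI)
  also have "(\<Sum>n. ennreal ((cmod (\<kappa> n * a n))\<^sup>2) * (\<integral>\<^sup>+z. ennreal (cmod z ^ (2 * n)) * V z \<partial>lborel))
      = (\<integral>\<^sup>+z. ennreal ((cmod (G z))\<^sup>2) * ?W z \<partial>lborel)"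
    unfolding GV by (rule radial_parseval[OF h h_holo V, symmetric])
      (simp add: V_def macdonald_weight_rotate norm_mult)
  also have "(\<Sum>n. ennreal ((cmod (a n))\<^sup>2) * ?m n) = (\<integral>\<^sup>+z. ennreal ((cmod (f z))\<^sup>2) * ?W z \<partial>lborel)"
    by (rule macdonald_parseval[OF a f, symmetric])
  finally show ?thesis .
qed

text \<open>For entire functions a comparison of moments is enough; the weights themselves need not
  be comparable in this direction near 0.\<close>

lemma macdonald_energy_compare:
  assumes f: "f holomorphic_on UNIV"
    and R: "\<And>n. macdonald_moment c \<tau> \<alpha> n \<le> ennreal R * macdonald_moment c \<tau> \<gamma> n"
  shows "(\<integral>\<^sup>+z. ennreal ((cmod z)\<^sup>2 * (cmod (f z))\<^sup>2) * macdonald_weight c \<tau> \<alpha> z \<partial>lborel)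
    \<le> ennreal R * (\<integral>\<^sup>+z. ennreal ((cmod z)\<^sup>2 * (cmod (f z))\<^sup>2) * macdonald_weight c \<tau> \<gamma> z \<partial>lborel)"
  unfolding macdonald_energy_parseval[OF entire_power_series[OF f] f] ennreal_suminf_cmult[symmetric]
    mult.left_commute[of "ennreal R"]
  by (intro suminf_le mult_left_mono R summableI) auto

section \<open>Entropy bounded by energy\<close>

text \<open>The logarithm of the pointwise bound is ln K + s |z|^2 + ln of the squared norm; the
  last term cancels the normalization in the entropy. The sign of ln K is unknown, hence the
  absolute value.\<close>

lemma entropy_le_energy:
  fixes f :: "complex \<Rightarrow> complex"
  assumes [measurable_cong]: "sets M = sets borel" and f: "f \<in> L2 M"
    and bound: "\<And>z. (cmod (f z))\<^sup>2 \<le> K * exp (s * (cmod z)\<^sup>2) * (L2_norm M f)\<^sup>2"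
    and K: "K > 0" and s: "s \<ge> 0" and E: "E \<ge> 0"
    and energy: "(\<integral>\<^sup>+z. ennreal ((cmod z)\<^sup>2 * (cmod (f z))\<^sup>2) \<partial>M) \<le> ennreal E"
  shows "entropy M f \<le> ereal (s * E + \<bar>ln K\<bar> * (L2_norm M f)\<^sup>2)"
proof -
  define N where "N = (L2_norm M f)\<^sup>2"
  have N0: "N \<ge> 0" by (simp add: N_def)
  have meas [measurable]: "f \<in> borel_measurable M" and int: "integrable M (\<lambda>x. (cmod (f x))\<^sup>2)"
    using f by (auto simp: L2_def)
  have N_int: "N = (LINT x|M. (cmod (f x))\<^sup>2)"
    by (simp add: N_def L2_norm_def)
  have "entropy M f \<le> ereal (s * E + \<bar>ln K\<bar> * N)"
  proof (cases "N = 0")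
    case True
    \<comment> \<open>The pointwise bound makes \<open>f\<close> vanish everywhere, not merely
      almost everywhere.\<close>
    then have "f z = 0" for z using bound[of z] by (simp add: N_def)
    then show ?thesis using True s E
      by (simp add: entropy_def N_def[symmetric] flip: zero_ereal_def)
  next
    case False
    then have N: "N > 0" using N0 by simp
    let ?g = "\<lambda>z. (cmod (f z))\<^sup>2 * ln ((cmod (f z))\<^sup>2)"
    let ?u = "\<lambda>z. s * ((cmod z)\<^sup>2 * (cmod (f z))\<^sup>2) + (ln K + ln N) * (cmod (f z))\<^sup>2"
    have gu: "?g z \<le> ?u z" for z
    proof (cases "f z = 0")
      case False
      have "ln ((cmod (f z))\<^sup>2) \<le> ln (K * exp (s * (cmod z)\<^sup>2) * N)"
        using bound[of z] False K N by (subst ln_le_cancel_iff) (auto simp: N_def)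
      also have "\<dots> = ln K + s * (cmod z)\<^sup>2 + ln N"
        using K N by (simp add: ln_mult)
      finally have "?g z \<le> (cmod (f z))\<^sup>2 * (ln K + s * (cmod z)\<^sup>2 + ln N)"
        by (rule mult_left_mono) simp
      then show ?thesis by (simp add: algebra_simps)
    qed simp
    have int_e: "integrable M (\<lambda>z. (cmod z)\<^sup>2 * (cmod (f z))\<^sup>2)"
      using energy by (intro integrableI_nonneg) (auto intro: le_less_trans)
    then have int_u: "integrable M ?u" using int by auto
    have "ennreal (LINT z|M. (cmod z)\<^sup>2 * (cmod (f z))\<^sup>2) \<le> ennreal E"
      using energy nn_integral_eq_integral[OF int_e] by simp
    then have lint_e: "(LINT z|M. (cmod z)\<^sup>2 * (cmod (f z))\<^sup>2) \<le> E"
      using E by (simp add: ennreal_le_iff)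
    have P: "(\<integral>\<^sup>+z. ennreal (?g z) \<partial>M) < \<infinity>"
    proof -
      have "(\<integral>\<^sup>+z. ennreal (?g z) \<partial>M) \<le> (\<integral>\<^sup>+z. ennreal (norm (?u z)) \<partial>M)"
        using gu by (intro nn_integral_mono ennreal_leI) (smt (verit) real_norm_def)
      also have "\<dots> < \<infinity>" using int_u by (simp add: integrable_iff_bounded)
      finally show ?thesis .
    qed
    show ?thesis
    proof (cases "(\<integral>\<^sup>+z. ennreal (- ?g z) \<partial>M) = \<infinity>")
      \<comment> \<open>The positive part is finite, so the entropy is -\<infinity> here.\<close>
      case True
      then show ?thesis using P
        by (cases "\<integral>\<^sup>+z. ennreal (?g z) \<partial>M") (auto simp: entropy_def)
    next
      case False
      have int_g: "integrable M ?g"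
        using P False by (auto simp: real_integrable_def)
      have pq: "enn2ereal (\<integral>\<^sup>+z. ennreal (?g z) \<partial>M) - enn2ereal (\<integral>\<^sup>+z. ennreal (- ?g z) \<partial>M) = ereal (LINT z|M. ?g z)"
        unfolding real_lebesgue_integral_def[OF int_g] using P False
        by (cases "\<integral>\<^sup>+z. ennreal (?g z) \<partial>M"; cases "\<integral>\<^sup>+z. ennreal (- ?g z) \<partial>M") (auto simp: enn2ereal_ennreal)
      have "(LINT z|M. ?g z) \<le> (LINT z|M. ?u z)"
        by (intro integral_mono int_g int_u gu)
      also have "\<dots> = s * (LINT z|M. (cmod z)\<^sup>2 * (cmod (f z))\<^sup>2) + (ln K + ln N) * N"
        using int_e int by (simp add: N_int)
      also have "\<dots> \<le> s * E + (\<bar>ln K\<bar> + ln N) * N"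
        using s N0 lint_e by (intro add_mono mult_left_mono mult_right_mono) auto
      finally show ?thesis
        unfolding entropy_def pq N_def[symmetric] by (simp add: algebra_simps)
    qed
  qed
  then show ?thesis by (simp add: N_def)
qed

text \<open>The operator exchanges parity, so \<open>f\<close> and \<open>G\<close> carry different
  orders \<alpha> and \<beta>. The energy is moved to an order \<gamma> below both, at the cost of
  \<open>R\<close>; there the Dunkl bound applies, and monotonicity of the weights leads back to
  \<beta> for \<open>G\<close> and \<alpha> for \<open>f\<close>.\<close>

lemma entropy_le_dunkl:
  assumes c: "c > 0" and \<tau>: "\<tau> \<ge> 0" and \<mu>: "\<mu> \<ge> 0"
    and \<gamma>: "\<bar>\<gamma>\<bar> \<le> \<bar>\<alpha>\<bar>" "\<bar>\<gamma>\<bar> \<le> \<bar>\<beta>\<bar>"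
    and R: "R > 0" "\<And>n. macdonald_moment c \<tau> \<alpha> n \<le> ennreal R * macdonald_moment c \<tau> \<gamma> n"
    and M: "M = density lborel (macdonald_weight c \<tau> \<alpha>)"
    and f: "f holomorphic_on UNIV" "f \<in> L2 M"
    and G: "\<And>z. z \<noteq> 0 \<Longrightarrow> G z = deriv f z + of_real \<mu> / z * (f z - f (- z))"
    and d: "(\<integral>\<^sup>+z. ennreal ((cmod (G z))\<^sup>2) * macdonald_weight c \<tau> \<beta> z \<partial>lborel) \<le> ennreal d" "d \<ge> 0"
    and L: "L = \<bar>ln (1 / (c * pi * Gamma (\<tau> + 1) * cosh 1 powr - (\<tau> + 1)))\<bar>"
  shows "entropy M f \<le> ereal (cosh 1 * (2 * (\<tau> + 1)\<^sup>2) * R * d + (cosh 1 * (\<tau> + 1) * R + L) * (L2_norm M f)\<^sup>2)"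
proof -
  define N where "N = (L2_norm M f)\<^sup>2"
  have N0: "N \<ge> 0" by (simp add: N_def)
  have [measurable]: "f \<in> borel_measurable borel"
    using f(1) by (intro borel_measurable_continuous_onI holomorphic_on_imp_continuous_on)
  have int: "integrable M (\<lambda>x. (cmod (f x))\<^sup>2)"
    using f(2) by (auto simp: L2_def)
  have "ennreal N = (\<integral>\<^sup>+z. ennreal ((cmod (f z))\<^sup>2) \<partial>M)"
    using nn_integral_eq_integral[OF int] by (simp add: N_def L2_norm_def)
  also have "\<dots> = (\<integral>\<^sup>+z. ennreal ((cmod (f z))\<^sup>2) * macdonald_weight c \<tau> \<alpha> z \<partial>lborel)"
    by (simp add: M nn_integral_density mult.commute)
  finally have N: "(\<integral>\<^sup>+z. ennreal ((cmod (f z))\<^sup>2) * macdonald_weight c \<tau> \<alpha> z \<partial>lborel) = ennreal N" ..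
  let ?A = "2 * (\<tau> + 1)\<^sup>2" and ?B = "\<tau> + 1"
  have "(\<integral>\<^sup>+z. ennreal ((cmod z)\<^sup>2 * (cmod (f z))\<^sup>2) \<partial>M) =
      (\<integral>\<^sup>+z. ennreal ((cmod z)\<^sup>2 * (cmod (f z))\<^sup>2) * macdonald_weight c \<tau> \<alpha> z \<partial>lborel)"
    by (simp add: M nn_integral_density mult.commute)
  also have "\<dots> \<le> ennreal R * (\<integral>\<^sup>+z. ennreal ((cmod z)\<^sup>2 * (cmod (f z))\<^sup>2) * macdonald_weight c \<tau> \<gamma> z \<partial>lborel)"
    by (rule macdonald_energy_compare[OF f(1) R(2)])
  also have "\<dots> \<le> ennreal R * (ennreal ?A * (\<integral>\<^sup>+z. ennreal ((cmod (G z))\<^sup>2) * macdonald_weight c \<tau> \<gamma> z \<partial>lborel)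
      + ennreal ?B * (\<integral>\<^sup>+z. ennreal ((cmod (f z))\<^sup>2) * macdonald_weight c \<tau> \<gamma> z \<partial>lborel))"
    by (intro mult_left_mono macdonald_energy_le_dunkl[OF f(1) c \<tau> \<mu> G]) auto
  also have "\<dots> \<le> ennreal R * (ennreal ?A * (\<integral>\<^sup>+z. ennreal ((cmod (G z))\<^sup>2) * macdonald_weight c \<tau> \<beta> z \<partial>lborel)
      + ennreal ?B * (\<integral>\<^sup>+z. ennreal ((cmod (f z))\<^sup>2) * macdonald_weight c \<tau> \<alpha> z \<partial>lborel))"
    using c \<gamma> by (intro mult_left_mono add_mono nn_integral_mono macdonald_weight_mono) auto
  also have "\<dots> \<le> ennreal R * (ennreal ?A * ennreal d + ennreal ?B * ennreal N)"
    unfolding N by (intro mult_left_mono add_mono d) auto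
  also have "\<dots> = ennreal (R * (?A * d + ?B * N))"
    using R(1) \<tau> d(2) N0 by (simp add: ennreal_mult ennreal_plus)
  finally have energy: "(\<integral>\<^sup>+z. ennreal ((cmod z)\<^sup>2 * (cmod (f z))\<^sup>2) \<partial>M) \<le> ennreal (R * (?A * d + ?B * N))" .
  let ?\<kappa> = "c * pi * Gamma (\<tau> + 1) * cosh 1 powr - (\<tau> + 1)"
  have \<kappa>: "?\<kappa> > 0" using c \<tau> by (intro mult_pos_pos) auto
  have "entropy M f \<le> ereal (cosh 1 * (R * (?A * d + ?B * N)) + \<bar>ln (1 / ?\<kappa>)\<bar> * (L2_norm M f)\<^sup>2)"
  proof (rule entropy_le_energy[OF _ f(2) _ _ _ _ energy])
    show "(cmod (f z))\<^sup>2 \<le> 1 / ?\<kappa> * exp (cosh 1 * (cmod z)\<^sup>2) * (L2_norm M f)\<^sup>2" for z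
      using entire_pointwise_bound[OF entire_power_series[OF f(1)] f(1) c \<tau> eq_refl[OF N] N0, of z]
      by (simp add: N_def)
  qed (use \<kappa> R(1) \<tau> d(2) N0 in \<open>auto simp: M\<close>)
  then show ?thesis
    unfolding L N_def[symmetric] by (simp add: algebra_simps)
qed

section \<open>Even and odd Bargmann spaces\<close>

lemma nu_e_eq: "nu_e \<mu> = density lborel
    (macdonald_weight (2 powr (1/2 - \<mu>) / (pi * Gamma (\<mu> + 1/2))) (\<mu> + 1/2) (\<mu> - 1/2))"
  by (simp add: nu_e_def dens_e_def macdonald_weight_def[abs_def])

lemma nu_o_eq: "nu_o \<mu> = density lborel
    (macdonald_weight (2 powr (1/2 - \<mu>) / (pi * Gamma (\<mu> + 1/2))) (\<mu> + 1/2) (\<mu> + 1/2))"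
  by (simp add: nu_o_def dens_o_def macdonald_weight_def[abs_def])

section \<open>Parity and the Dunkl operator\<close>

lemma D_nonzero:
  assumes f: "f holomorphic_on UNIV" and z: "z \<noteq> 0"
  shows "D \<mu> f z = deriv f z + of_real \<mu> / z * (f z - f (- z))"
  unfolding D_def
proof (rule remove_sings_at_analytic)
  have "(\<lambda>z. deriv f z + of_real \<mu> / z * (f z - f (- z))) holomorphic_on UNIV - {0}"
    using f by (intro holomorphic_intros holomorphic_on_compose_gen[OF _ f, unfolded o_def])
      (auto intro: holomorphic_on_subset)
  then show "(\<lambda>z. deriv f z + of_real \<mu> / z * (f z - f (- z))) analytic_on {z}"
    using z by (auto simp: analytic_at intro!: exI[of _ "UNIV - {0}"] open_delete)
qed

lemma deriv_reflect:
  assumes "f holomorphic_on UNIV"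
  shows "deriv (\<lambda>z. f (- z)) z = - deriv f (- z)"
proof -
  have "(f has_field_derivative deriv f (- z)) (at (- z))"
    using assms by (auto intro: holomorphic_derivI)
  moreover have "(uminus has_field_derivative - 1) (at z)"
    by (auto intro!: derivative_eq_intros)
  ultimately have "((\<lambda>z. f (- z)) has_field_derivative deriv f (- z) * - 1) (at z)"
    by (rule DERIV_chain2)
  then show ?thesis by (simp add: DERIV_imp_deriv)
qed

text \<open>Differentiation turns even functions into odd ones, so off 0 the odd part of
  \<open>D \<mu> f\<close> is all of it. This is the part that \<open>B2_norm\<close> measures with
  \<open>nu_o\<close>.\<close>

lemma odd_part_D:
  assumes f: "f holomorphic_on UNIV" "\<And>z. f (- z) = f z" and z: "z \<noteq> 0"
  shows "odd_part (D \<mu> f) z = deriv f z + of_real \<mu> / z * (f z - f (- z))"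
  using deriv_reflect[OF f(1), of z] z
  by (simp add: odd_part_def D_nonzero f)

lemma even_part_D:
  assumes f: "f holomorphic_on UNIV" "\<And>z. f (- z) = - f z" and z: "z \<noteq> 0"
  shows "even_part (D \<mu> f) z = deriv f z + of_real \<mu> / z * (f z - f (- z))"
proof -
  have "f field_differentiable at z"
    using f(1) by (simp add: holomorphic_on_imp_differentiable_at)
  then have "deriv f (- z) = deriv f z"
    using deriv_reflect[OF f(1), of z] by (simp add: f(2))
  then show ?thesis
    using z by (simp add: even_part_def D_nonzero f field_simps)
qed

lemma even_part_in_B2_e:
  assumes "f \<in> B2 \<mu>"
  shows "even_part f \<in> B2_e \<mu>"
proof -
  have "even_part (even_part f) = even_part f" "odd_part (even_part f) = (\<lambda>_. 0)"
    by (auto simp: even_part_def odd_part_def add.commute fun_eq_iff)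
  moreover have "even_part f holomorphic_on UNIV"
    using assms unfolding even_part_def[abs_def] B2_def
    by (auto intro!: holomorphic_intros holomorphic_on_compose_gen[of uminus UNIV f, unfolded o_def])
  ultimately show ?thesis
    using assms by (auto simp: B2_e_def B2_def L2_def even_part_def add.commute)
qed

lemma odd_part_in_B2_o:
  assumes "f \<in> B2 \<mu>"
  shows "odd_part f \<in> B2_o \<mu>"
proof -
  have "odd_part (odd_part f) = odd_part f" "even_part (odd_part f) = (\<lambda>_. 0)"
    by (auto simp: even_part_def odd_part_def fun_eq_iff field_simps)
  moreover have "odd_part f holomorphic_on UNIV"
    using assms unfolding odd_part_def[abs_def] B2_def
    by (auto intro!: holomorphic_intros holomorphic_on_compose_gen[of uminus UNIV f, unfolded o_def])
  moreover have "odd_part f (- z) = - odd_part f z" for z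
    by (simp add: odd_part_def field_simps)
  ultimately show ?thesis
    using assms by (auto simp: B2_o_def B2_def L2_def)
qed

lemma nn_integral_eq_L2_norm:
  assumes "f \<in> L2 M"
  shows "(\<integral>\<^sup>+x. ennreal ((cmod (f x))\<^sup>2) \<partial>M) = ennreal ((L2_norm M f)\<^sup>2)"
  using assms nn_integral_eq_integral[of M "\<lambda>x. (cmod (f x))\<^sup>2"] by (simp add: L2_def L2_norm_def)

text \<open>For \<mu> = 0 the orders 1/2 and -1/2 have equal modulus and the weights coincide, which
  allows C = 1. Otherwise any constant from the moment comparison can be enlarged.\<close>

lemma macdonald_moment_odd_le_even:
  assumes "\<mu> \<ge> 0" and c: "c > 0"
  shows "\<exists>C > 0. (\<mu> > 0 \<longrightarrow> C < 1) \<and> (\<mu> = 0 \<longrightarrow> C = 1) \<and>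
    (\<forall>n. macdonald_moment c (\<mu> + 1/2) (\<mu> + 1/2) n \<le> ennreal (inverse C) * macdonald_moment c (\<mu> + 1/2) (\<mu> - 1/2) n)"
proof (cases "\<mu> = 0")
  case True
  have "macdonald_moment c (\<mu> + 1/2) (\<mu> + 1/2) n \<le> macdonald_moment c (\<mu> + 1/2) (\<mu> - 1/2) n" for n
    unfolding macdonald_moment_def using c True
    by (intro nn_integral_mono mult_left_mono macdonald_weight_mono) auto
  then show ?thesis using True by (intro exI[of _ 1]) auto
next
  case False
  obtain R where R: "R > 0"
    "\<And>n. macdonald_moment c (\<mu> + 1/2) (\<mu> + 1/2) n \<le> ennreal R * macdonald_moment c (\<mu> + 1/2) (\<mu> - 1/2) n"
    using macdonald_moment_compare[OF c, of "\<mu> + 1/2" "\<mu> + 1/2" "\<mu> - 1/2"] assms by auto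
  \<comment> \<open>Adding 1 to \<open>R\<close> makes C < 1 whatever the size of
    \<open>R\<close>.\<close>
  define C where "C = inverse (R + 1)"
  have "R \<le> inverse C" by (simp add: C_def)
  then have "macdonald_moment c (\<mu> + 1/2) (\<mu> + 1/2) n \<le> ennreal (inverse C) * macdonald_moment c (\<mu> + 1/2) (\<mu> - 1/2) n" for n
    by (intro order_trans[OF R(2)] mult_right_mono ennreal_leI) auto
  moreover have "C > 0" "C < 1" using R(1) by (auto simp: C_def field_simps)
  ultimately show ?thesis using False by blast
qed

text \<open>Brings the entropy bound into the shape of the theorem with entropy coefficient 1;
  enlarging \<open>p\<close> to \<open>q\<close> is harmless in front of a squared norm.\<close>

lemma ereal_scaled_le:
  fixes b d N p q :: real
  assumes "x \<le> ereal (b * d + p * N)" "p \<le> q" "N \<ge> 0"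
  shows "ereal 1 * x \<le> ereal b * ereal d + ereal (q * N)"
proof -
  have "b * d + p * N \<le> b * d + q * N" using assms by (intro add_left_mono mult_right_mono)
  then have "ereal (b * d + p * N) \<le> ereal (b * d + q * N)" by simp
  with assms(1) show ?thesis by (simp add: order_trans flip: one_ereal_def)
qed

theorem theorem5p3:
  fixes \<mu> :: real
  assumes "\<mu> \<ge> 0"
  shows "\<exists>C :: real. C > 0 \<and> (\<mu> > 0 \<longrightarrow> C < 1) \<and> (\<mu> = 0 \<longrightarrow> C = 1) \<and>
    (\<forall>f \<in> B2_o \<mu>. ennreal C * energy_o \<mu> f
        \<le> (\<integral>\<^sup>+z. ennreal ((cmod z)\<^sup>2 * (cmod (f z))\<^sup>2) \<partial>nu_e \<mu>)) \<and>
    (\<exists>a\<^sub>e b\<^sub>e c\<^sub>e a\<^sub>o b\<^sub>o c\<^sub>o :: real.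
      a\<^sub>e > 0 \<and> b\<^sub>e > 0 \<and> c\<^sub>e \<ge> 0 \<and> a\<^sub>o > 0 \<and> b\<^sub>o > 0 \<and> c\<^sub>o \<ge> 0 \<and>
      (\<forall>f \<in> B2_e \<mu>.
        ereal a\<^sub>e * entropy (nu_e \<mu>) f
          \<le> ereal b\<^sub>e * dirichlet_energy \<mu> f
            + ereal ((b\<^sub>e * (1 + 2 * \<mu>) + c\<^sub>e) * (L2_norm (nu_e \<mu>) f)\<^sup>2)) \<and>
      (\<forall>f \<in> B2_o \<mu>.
        ereal a\<^sub>o * entropy (nu_o \<mu>) f
          \<le> ereal (b\<^sub>o * inverse C) * dirichlet_energy \<mu> f
            + ereal ((b\<^sub>o * inverse C * (1 - 2 * \<mu>) + c\<^sub>o) * (L2_norm (nu_o \<mu>) f)\<^sup>2)) \<and>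
      (\<forall>f \<in> B2 \<mu>.
        ereal a\<^sub>e * entropy (nu_e \<mu>) (even_part f) + ereal a\<^sub>o * entropy (nu_o \<mu>) (odd_part f)
          \<le> ereal b\<^sub>e * dirichlet_energy \<mu> (even_part f)
            + ereal (b\<^sub>o * inverse C) * dirichlet_energy \<mu> (odd_part f)
            + ereal ((b\<^sub>e * (1 + 2 * \<mu>) + c\<^sub>e) * (L2_norm (nu_e \<mu>) (even_part f))\<^sup>2)
            + ereal ((b\<^sub>o * inverse C * (1 - 2 * \<mu>) + c\<^sub>o) * (L2_norm (nu_o \<mu>) (odd_part f))\<^sup>2)))"
proof -
  define c where "c = 2 powr (1/2 - \<mu>) / (pi * Gamma (\<mu> + 1/2))"
  define \<tau> where "\<tau> = \<mu> + 1/2"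
  define We where "We = macdonald_weight c \<tau> (\<mu> - 1/2)"
  define Wo where "Wo = macdonald_weight c \<tau> (\<mu> + 1/2)"
  have c: "c > 0" unfolding c_def using assms by (intro divide_pos_pos mult_pos_pos) auto
  have \<tau>: "\<tau> \<ge> 0" using assms by (simp add: \<tau>_def)
  have nu: "nu_e \<mu> = density lborel We" "nu_o \<mu> = density lborel Wo"
    by (simp_all add: nu_e_eq nu_o_eq We_def Wo_def c_def \<tau>_def)
  have [measurable]: "We \<in> borel_measurable borel" "Wo \<in> borel_measurable borel"
    by (simp_all add: We_def Wo_def)
  obtain C where C: "C > 0" "\<mu> > 0 \<longrightarrow> C < 1" "\<mu> = 0 \<longrightarrow> C = 1" and
    mom: "\<And>n. macdonald_moment c \<tau> (\<mu> + 1/2) n \<le> ennreal (inverse C) * macdonald_moment c \<tau> (\<mu> - 1/2) n"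
    using macdonald_moment_odd_le_even[OF assms c] unfolding \<tau>_def by blast
  define R where "R = inverse C"
  have R: "R > 0" using C by (simp add: R_def)
  \<comment> \<open>The constant of the pointwise bound does not involve the order, so one
    \<open>L\<close> serves both parities.\<close>
  define L where "L = \<bar>ln (1 / (c * pi * Gamma (\<tau> + 1) * cosh 1 powr - (\<tau> + 1)))\<bar>"
  \<comment> \<open>Product of the exponent \<open>cosh 1\<close> of the pointwise bound and the
    constant of the Dunkl bound. In the odd case the further factor \<open>R\<close> is the inverse
    of \<open>C\<close> that the theorem displays.\<close>
  define b where "b = cosh 1 * (2 * (\<tau> + 1)\<^sup>2)"
  define c\<^sub>e where "c\<^sub>e = cosh 1 * (\<tau> + 1) * 1 + L"
  \<comment> \<open>The absolute value makes up for 1 - 2 \<mu>, which may be negative.\<close>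
  define c\<^sub>o where "c\<^sub>o = cosh 1 * (\<tau> + 1) * R + L + \<bar>b * R * (1 - 2 * \<mu>)\<bar>"
  have b: "b > 0" unfolding b_def using \<tau> by (intro mult_pos_pos) auto
  have pos: "c\<^sub>e \<ge> 0" "c\<^sub>o \<ge> 0"
    using \<tau> R by (auto simp: c\<^sub>e_def c\<^sub>o_def L_def)

  have energy: "ennreal C * energy_o \<mu> f \<le> (\<integral>\<^sup>+z. ennreal ((cmod z)\<^sup>2 * (cmod (f z))\<^sup>2) \<partial>nu_e \<mu>)"
    if f: "f \<in> B2_o \<mu>" for f
  proof -
    have holo: "f holomorphic_on UNIV" using f by (simp add: B2_o_def B2_def)
    have [measurable]: "f \<in> borel_measurable borel"
      using holo by (intro borel_measurable_continuous_onI holomorphic_on_imp_continuous_on)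
    have "energy_o \<mu> f \<le> ennreal (inverse C) * (\<integral>\<^sup>+z. ennreal ((cmod z)\<^sup>2 * (cmod (f z))\<^sup>2) \<partial>nu_e \<mu>)"
      using macdonald_energy_compare[OF holo mom]
      by (simp add: energy_o_def nu nn_integral_density We_def Wo_def mult.commute)
    then have "ennreal C * energy_o \<mu> f \<le> ennreal C * ennreal (inverse C) * (\<integral>\<^sup>+z. ennreal ((cmod z)\<^sup>2 * (cmod (f z))\<^sup>2) \<partial>nu_e \<mu>)"
      unfolding mult.assoc by (rule mult_left_mono) simp
    also have "ennreal C * ennreal (inverse C) = 1" using C by (simp flip: ennreal_mult)
    finally show ?thesis by simp
  qed

  have even: "ereal 1 * entropy (nu_e \<mu>) f \<le> ereal b * dirichlet_energy \<mu> f
      + ereal ((b * (1 + 2 * \<mu>) + c\<^sub>e) * (L2_norm (nu_e \<mu>) f)\<^sup>2)" if f: "f \<in> B2_e \<mu>" for f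
  proof (cases "D \<mu> f \<in> B2 \<mu>")
    case True
    have holo: "f holomorphic_on UNIV" and sym: "f (- z) = f z" for z
      using f by (auto simp: B2_e_def B2_def)
    have "even_part f = f" by (simp add: even_part_def fun_eq_iff sym)
    then have L2: "f \<in> L2 (nu_e \<mu>)" using f by (auto simp: B2_e_def B2_def)
    let ?G = "odd_part (D \<mu> f)"
    have G: "?G \<in> L2 (nu_o \<mu>)" using True by (simp add: B2_def)
    then have [measurable]: "?G \<in> borel_measurable borel" by (simp add: L2_def nu)
    have "(\<integral>\<^sup>+z. ennreal ((cmod (?G z))\<^sup>2) * Wo z \<partial>lborel) = ennreal ((L2_norm (nu_o \<mu>) ?G)\<^sup>2)"
      using nn_integral_eq_L2_norm[OF G] by (simp add: nu nn_integral_density mult.commute)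
    also have "\<dots> \<le> ennreal ((B2_norm \<mu> (D \<mu> f))\<^sup>2)"
      by (simp add: B2_norm_def)
    finally have d: "(\<integral>\<^sup>+z. ennreal ((cmod (?G z))\<^sup>2) * macdonald_weight c \<tau> (\<mu> + 1/2) z \<partial>lborel)
        \<le> ennreal ((B2_norm \<mu> (D \<mu> f))\<^sup>2)" by (simp add: Wo_def)
    \<comment> \<open>Here \<gamma> = \<alpha> = \<mu> - 1/2 is already the smaller order, so the
      comparison constant is 1.\<close>
    have "entropy (nu_e \<mu>) f \<le> ereal (b * 1 * (B2_norm \<mu> (D \<mu> f))\<^sup>2 + c\<^sub>e * (L2_norm (nu_e \<mu>) f)\<^sup>2)"
      unfolding b_def c\<^sub>e_def
      by (rule entropy_le_dunkl[OF c \<tau> assms, where \<gamma> = "\<mu> - 1/2", OF _ _ _ _ nu(1)[unfolded We_def] holo L2 odd_part_D[OF holo sym] d _ L_def])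
        (use assms in auto)
    then show ?thesis
      using ereal_scaled_le[of _ b _ c\<^sub>e "(L2_norm (nu_e \<mu>) f)\<^sup>2" "b * (1 + 2 * \<mu>) + c\<^sub>e"] True b assms
      by (simp add: dirichlet_energy_def)
  next
    \<comment> \<open>The Dirichlet energy is \<infinity> and its coefficient is positive.\<close>
    case False
    then show ?thesis using b by (simp add: dirichlet_energy_def)
  qed

  have odd: "ereal 1 * entropy (nu_o \<mu>) f \<le> ereal (b * R) * dirichlet_energy \<mu> f
      + ereal ((b * R * (1 - 2 * \<mu>) + c\<^sub>o) * (L2_norm (nu_o \<mu>) f)\<^sup>2)" if f: "f \<in> B2_o \<mu>" for f
  proof (cases "D \<mu> f \<in> B2 \<mu>")
    case True
    have holo: "f holomorphic_on UNIV" and sym: "f (- z) = - f z" for z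
      using f by (auto simp: B2_o_def B2_def)
    have "odd_part f = f" by (simp add: odd_part_def fun_eq_iff sym)
    then have L2: "f \<in> L2 (nu_o \<mu>)" using f by (auto simp: B2_o_def B2_def)
    let ?G = "even_part (D \<mu> f)"
    have G: "?G \<in> L2 (nu_e \<mu>)" using True by (simp add: B2_def)
    then have [measurable]: "?G \<in> borel_measurable borel" by (simp add: L2_def nu)
    have "(\<integral>\<^sup>+z. ennreal ((cmod (?G z))\<^sup>2) * We z \<partial>lborel) = ennreal ((L2_norm (nu_e \<mu>) ?G)\<^sup>2)"
      using nn_integral_eq_L2_norm[OF G] by (simp add: nu nn_integral_density mult.commute)
    also have "\<dots> \<le> ennreal ((B2_norm \<mu> (D \<mu> f))\<^sup>2)"
      by (simp add: B2_norm_def)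
    finally have d: "(\<integral>\<^sup>+z. ennreal ((cmod (?G z))\<^sup>2) * macdonald_weight c \<tau> (\<mu> - 1/2) z \<partial>lborel)
        \<le> ennreal ((B2_norm \<mu> (D \<mu> f))\<^sup>2)" by (simp add: We_def)
    \<comment> \<open>Here \<gamma> = \<beta> = \<mu> - 1/2 lies below \<alpha> = \<mu> + 1/2, and
      the descent costs \<open>R\<close>.\<close>
    have "entropy (nu_o \<mu>) f \<le> ereal (b * R * (B2_norm \<mu> (D \<mu> f))\<^sup>2 + (cosh 1 * (\<tau> + 1) * R + L) * (L2_norm (nu_o \<mu>) f)\<^sup>2)"
      unfolding b_def
      by (rule entropy_le_dunkl[OF c \<tau> assms _ _ R mom[folded R_def] nu(2)[unfolded Wo_def] holo L2 even_part_D[OF holo sym] d _ L_def])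
        (use assms in auto)
    moreover have "cosh 1 * (\<tau> + 1) * R + L \<le> b * R * (1 - 2 * \<mu>) + c\<^sub>o"
      by (simp add: c\<^sub>o_def)
    ultimately show ?thesis
      using ereal_scaled_le[of _ "b * R" _ "cosh 1 * (\<tau> + 1) * R + L" "(L2_norm (nu_o \<mu>) f)\<^sup>2"] True
      by (simp add: dirichlet_energy_def)
  next
    case False
    then show ?thesis using b R by (simp add: dirichlet_energy_def)
  qed

  have both: "ereal 1 * entropy (nu_e \<mu>) (even_part f) + ereal 1 * entropy (nu_o \<mu>) (odd_part f)
          \<le> ereal b * dirichlet_energy \<mu> (even_part f)
            + ereal (b * R) * dirichlet_energy \<mu> (odd_part f)
            + ereal ((b * (1 + 2 * \<mu>) + c\<^sub>e) * (L2_norm (nu_e \<mu>) (even_part f))\<^sup>2)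
            + ereal ((b * R * (1 - 2 * \<mu>) + c\<^sub>o) * (L2_norm (nu_o \<mu>) (odd_part f))\<^sup>2)"
    if "f \<in> B2 \<mu>" for f
    using add_mono[OF even[OF even_part_in_B2_e[OF that]] odd[OF odd_part_in_B2_o[OF that]]]
    by (simp only: ac_simps)
  show ?thesis
    by (rule exI[of _ C], intro conjI C ballI, erule energy,
        rule exI[of _ 1], rule exI[of _ b], rule exI[of _ c\<^sub>e],
        rule exI[of _ 1], rule exI[of _ b], rule exI[of _ c\<^sub>o],
        intro conjI ballI b pos zero_less_one,
        erule even, erule odd[unfolded R_def], erule both[unfolded R_def])
qed

end
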